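(* Let $(M,d)$ be a proper metric space and let $X$ be a Banach space without cotype (i.e. without any nontrivial cotype). Then $M$ strongly uniformly embeds into $X$; that is, there exists an injective map $f:M\to X$ which is simultaneously a uniform embedding and a coarse embedding.
   Context: A metric space is proper if all its closed balls are compact. Banach spaces are real. A Banach space $X$ is without cotype (has no nontrivial cotype) if it does not have (Rademacher) cotype $q$ for any $q\in[2,\infty)$. Equivalently, $X$ uniformly contains the $\ell_\infty^n$'s: there is a constant $C\ge 1$ such that for every integer $n\geq 1$, $X$ has an $n$-dimensional subspace $Y$ with Banach–Mazur distance $d_{BM}(\ell_\infty^n,Y)\le C$. For a map $f:(M,d)\to(N,\delta)$ between metric spaces and $t>0$, put $$\rho_f(t)=\inf\{\delta(f(x),f(y)) : d(x,y)\ge t\},\qquad \omega_f(t)=\sup\{\delta(f(x),f(y)) : d(x,y)\le t\},$$ with the convention $\inf\emptyset=+\infty$. The map $f$ is a coarse embedding if $\omega_f(t)<\infty$ for all $t>0$ and $\lim_{t\to\infty}\rho_f(t)=\infty$. An injective map $f$ is a uniform embedding if $f$ and $f^{-1}:f(M)\to M$ are uniformly continuous, i.e. $\omega_f(t)\to 0$ and $\omega_{f^{-1}}(t)\to 0$ as $t\to 0$. A strong uniform embedding is a map which is both a uniform embedding and a coarse embedding. *)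

theory Defs
  imports "HOL-Analysis.Analysis"
begin

text \<open>A metric space is a set \<open>M\<close> with the metric inherited from its type; the case
  \<open>M = UNIV\<close> is that of a whole type of class \<^class>\<open>metric_space\<close>. Maps out of \<open>M\<close> are total
  functions of which only the values on \<open>M\<close> matter.\<close>

definition proper_space :: "'a::metric_space set \<Rightarrow> bool" where
  "proper_space M \<longleftrightarrow> (\<forall>x\<in>M. \<forall>r. compact (M \<inter> cball x r))"

text \<open>The average runs over all \<open>2 ^ n\<close> choices of signs, i.e. it is the expectation over
  independent Rademacher variables. By Kahane's inequality, replacing the second moment by any
  other finite moment yields the same notion.\<close>

definition has_cotype :: "'b::real_normed_vector itself \<Rightarrow> real \<Rightarrow> bool" where
  "has_cotype X q \<longleftrightarrow>
     (\<exists>C. \<forall>n. \<forall>x :: nat \<Rightarrow> 'b.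
        (\<Sum>i<n. norm (x i) powr q) powr (1 / q)
          \<le> C * sqrt ((\<Sum>\<epsilon> \<in> {..<n} \<rightarrow>\<^sub>E {-1, 1}. (norm (\<Sum>i<n. \<epsilon> i *\<^sub>R x i))\<^sup>2) / 2 ^ n))"

definition without_cotype :: "'b::real_normed_vector itself \<Rightarrow> bool" where
  "without_cotype X \<longleftrightarrow> (\<forall>q\<ge>2. \<not> has_cotype X q)"

text \<open>Both moduli take values in \<open>[0, \<infinity>]\<close>, where the infimum of the empty set is \<open>\<infinity>\<close>.\<close>

definition compression_modulus ::
    "'a::metric_space set \<Rightarrow> ('a \<Rightarrow> 'b::metric_space) \<Rightarrow> real \<Rightarrow> ennreal" where
  "compression_modulus M f t =
     Inf {ennreal (dist (f x) (f y)) | x y. x \<in> M \<and> y \<in> M \<and> dist x y \<ge> t}"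

definition expansion_modulus ::
    "'a::metric_space set \<Rightarrow> ('a \<Rightarrow> 'b::metric_space) \<Rightarrow> real \<Rightarrow> ennreal" where
  "expansion_modulus M f t =
     Sup {ennreal (dist (f x) (f y)) | x y. x \<in> M \<and> y \<in> M \<and> dist x y \<le> t}"

definition coarse_embedding ::
    "'a::metric_space set \<Rightarrow> ('a \<Rightarrow> 'b::metric_space) \<Rightarrow> bool" where
  "coarse_embedding M f \<longleftrightarrow>
     (\<forall>t>0. expansion_modulus M f t < \<infinity>) \<and>
     (compression_modulus M f \<longlongrightarrow> \<infinity>) at_top"

lemma uniformly_continuous_on_iff_expansion_modulus:
  "uniformly_continuous_on M f \<longleftrightarrow> (expansion_modulus M f \<longlongrightarrow> 0) (at_right 0)"
proof
  assume uc: "uniformly_continuous_on M f"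
  show "(expansion_modulus M f \<longlongrightarrow> 0) (at_right 0)"
  proof (rule order_tendstoI)
    fix a :: ennreal assume "0 < a"
    then obtain b where b: "0 < b" "b < a" using dense by blast
    then have "b < \<infinity>" by (metis infinity_ennreal_def order_less_le_trans top_greatest)
    then obtain e where e: "b = ennreal e" "0 < e"
      using b(1) by (cases b) auto
    obtain d where d: "d > 0"
        "\<And>x y. x \<in> M \<Longrightarrow> y \<in> M \<Longrightarrow> dist x y < d \<Longrightarrow> dist (f x) (f y) < e"
      using uc e(2) unfolding uniformly_continuous_on_def by (metis dist_commute)
    have "expansion_modulus M f t < a" if "t < d" for t
    proof -
      have "expansion_modulus M f t \<le> b"
        unfolding expansion_modulus_def e(1)
        by (rule Sup_least) (use d(2) that in \<open>force intro: ennreal_leI less_imp_le\<close>)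
      with b(2) show ?thesis by simp
    qed
    then show "\<forall>\<^sub>F t in at_right 0. expansion_modulus M f t < a"
      using d(1) by (auto simp: eventually_at_right_field)
  qed simp
next
  assume lim: "(expansion_modulus M f \<longlongrightarrow> 0) (at_right 0)"
  show "uniformly_continuous_on M f"
    unfolding uniformly_continuous_on_def
  proof (intro allI impI)
    fix e :: real assume "0 < e"
    then have "\<forall>\<^sub>F t in at_right 0. expansion_modulus M f t < ennreal e"
      by (intro order_tendstoD(2)[OF lim]) simp
    then obtain d where d: "d > 0" "\<And>t. 0 < t \<Longrightarrow> t < d \<Longrightarrow> expansion_modulus M f t < ennreal e"
      by (auto simp: eventually_at_right_field)
    have "dist (f y) (f x) < e" if "x \<in> M" "y \<in> M" "dist y x < d / 2" for x y
    proof -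
      have "ennreal (dist (f y) (f x)) \<le> expansion_modulus M f (d / 2)"
        unfolding expansion_modulus_def by (rule Sup_upper) (use that in force)
      also have "\<dots> < ennreal e" using d by simp
      finally show ?thesis by (simp add: ennreal_less_iff)
    qed
    then show "\<exists>d>0. \<forall>x\<in>M. \<forall>x'\<in>M. dist x' x < d \<longrightarrow> dist (f x') (f x) < e"
      using d(1) by (intro exI[of _ "d / 2"]) auto
  qed
qed

definition uniform_embedding ::
    "'a::metric_space set \<Rightarrow> ('a \<Rightarrow> 'b::metric_space) \<Rightarrow> bool" where
  "uniform_embedding M f \<longleftrightarrow>
     inj_on f M \<and>
     uniformly_continuous_on M f \<and>
     uniformly_continuous_on (f ` M) (inv_into M f)"

definition strong_uniform_embedding ::
    "'a::metric_space set \<Rightarrow> ('a \<Rightarrow> 'b::metric_space) \<Rightarrow> bool" where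
  "strong_uniform_embedding M f \<longleftrightarrow> uniform_embedding M f \<and> coarse_embedding M f"

end

theory Submission
  imports Defs
begin

text \<open>
  A space without cotype contains almost isometric copies of all \<open>\<ell>\<^sub>\<infinity>\<^sup>n\<close>: the quotient of
  \<open>\<Sum>\<parallel>x\<^sub>i\<parallel>\<^sup>2\<close> by the Rademacher average is bounded by a submultiplicative function of the number of
  vectors, so that a bound \<open>c < n\<close> for a single \<open>n\<close> would yield power decay and hence a finite cotype.
  Such copies can be chosen successively to form a decomposition with bounded coordinate
  functionals, each new copy being almost orthogonal to the compact unit sphere of the span of the
  previous ones.

  A proper space is cut into dyadic shells around a base point. For each shell and each
  precision \<open>2\<^sup>-\<^sup>j\<close>, bumps centred at a finite net give a Lipschitz map into one copy. Since a point
  meets only three shells and precision \<open>2\<^sup>-\<^sup>j\<close> is weighted by \<open>2\<^sup>-\<^sup>j\<close>, the sum of these maps is Lipschitz,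
  while the coordinate functionals recover \<open>2\<^sup>-\<^sup>j d(x, y)\<close>, up to a constant, as soon as \<open>d(x, y)\<close> is large
  compared with \<open>2\<^sup>-\<^sup>j\<close>.
\<close>

section \<open>Rademacher averages and cotype\<close>

abbreviation signs :: "'i set \<Rightarrow> ('i \<Rightarrow> real) set" where
  "signs A \<equiv> A \<rightarrow>\<^sub>E {-1, 1}"

lemma card_signs: "finite A \<Longrightarrow> card (signs A) = 2 ^ card A"
  by (simp add: card_PiE numeral_2_eq_2)

text \<open>Multiplying by the fixed pattern \<open>\<delta>\<close> is an involution of
  \<open>signs A\<close>; restricting to \<open>A\<close> keeps the product extensional.\<close>

lemma sum_signs_flip:
  assumes "\<And>i. i \<in> A \<Longrightarrow> \<delta> i \<in> {-1, 1}"
  shows "(\<Sum>\<epsilon>\<in>signs A. F (\<lambda>i\<in>A. \<delta> i * \<epsilon> i)) = (\<Sum>\<epsilon>\<in>signs A. F \<epsilon>)"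
proof -
  have sq: "\<delta> i * \<delta> i = 1" if "i \<in> A" for i using assms[OF that] by auto
  have inv: "(\<lambda>i\<in>A. \<delta> i * (\<lambda>i\<in>A. \<delta> i * \<epsilon> i) i) = \<epsilon>" if "\<epsilon> \<in> signs A" for \<epsilon>
  proof
    fix i
    show "(\<lambda>i\<in>A. \<delta> i * (\<lambda>i\<in>A. \<delta> i * \<epsilon> i) i) i = \<epsilon> i"
      using sq[of i] PiE_arb[OF that, of i] by (cases "i \<in> A") (auto simp: mult.assoc[symmetric])
  qed
  have mem: "(\<lambda>i\<in>A. \<delta> i * \<epsilon> i) \<in> signs A" if "\<epsilon> \<in> signs A" for \<epsilon>
  proof (rule restrict_PiE_iff[THEN iffD2], rule ballI)
    fix i assume "i \<in> A"
    with assms[of i] PiE_mem[OF that, of i] show "\<delta> i * \<epsilon> i \<in> {-1, 1}" by auto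
  qed
  show ?thesis
    by (rule sum.reindex_bij_witness[where i = "\<lambda>\<epsilon>. \<lambda>i\<in>A. \<delta> i * \<epsilon> i" and j = "\<lambda>\<epsilon>. \<lambda>i\<in>A. \<delta> i * \<epsilon> i"])
      (use inv mem in auto)
qed

text \<open>The signs range over \<open>A\<close> although only the indices in \<open>B\<close> are summed; averages over different
  subsets \<open>B\<close> are thus taken on one common probability space.\<close>

definition sq_avg :: "'i set \<Rightarrow> 'i set \<Rightarrow> ('i \<Rightarrow> 'b::real_normed_vector) \<Rightarrow> real" where
  "sq_avg A B x = (\<Sum>\<epsilon>\<in>signs A. (norm (\<Sum>i\<in>B. \<epsilon> i *\<^sub>R x i))\<^sup>2) / 2 ^ card A"

lemma sq_avg_nonneg: "0 \<le> sq_avg A B x"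
  by (simp add: sq_avg_def sum_nonneg)

lemma sq_avg_flip:
  assumes "B \<subseteq> A" "\<And>i. i \<in> A \<Longrightarrow> \<delta> i \<in> {-1, 1}"
  shows "(\<Sum>\<epsilon>\<in>signs A. (norm (\<Sum>i\<in>B. (\<delta> i * \<epsilon> i) *\<^sub>R x i))\<^sup>2) / 2 ^ card A = sq_avg A B x"
proof -
  have "(\<Sum>i\<in>B. (\<delta> i * \<epsilon> i) *\<^sub>R x i) = (\<Sum>i\<in>B. (\<lambda>i\<in>A. \<delta> i * \<epsilon> i) i *\<^sub>R x i)" for \<epsilon> :: "_ \<Rightarrow> real"
    using assms(1) by (intro sum.cong) auto
  then show ?thesis
    unfolding sq_avg_def
    using sum_signs_flip[of A \<delta> "\<lambda>\<epsilon>. (norm (\<Sum>i\<in>B. \<epsilon> i *\<^sub>R x i))\<^sup>2", OF assms(2)] by simp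
qed

lemma norm_half_add_sq_le:
  "(norm ((1/2) *\<^sub>R (u + v)))\<^sup>2 \<le> ((norm u)\<^sup>2 + (norm v)\<^sup>2) / 2" for u v :: "'b::real_normed_vector"
proof -
  have "norm ((1/2) *\<^sub>R (u + v)) \<le> (norm u + norm v) / 2"
    using norm_triangle_ineq[of u v] by simp
  then have "(norm ((1/2) *\<^sub>R (u + v)))\<^sup>2 \<le> ((norm u + norm v) / 2)\<^sup>2"
    by (rule power_mono) simp
  also have "\<dots> \<le> ((norm u)\<^sup>2 + (norm v)\<^sup>2) / 2"
    using zero_le_power2[of "norm u - norm v"] by (simp add: power2_eq_square field_simps)
  finally show ?thesis .
qed

text \<open>The sum over \<open>B\<close> is the mean of the full sum and the full sum with the
  signs outside \<open>B\<close> flipped. Both have the same average, and the squared norm is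
  convex.\<close>

lemma sq_avg_mono:
  assumes "finite A" "B \<subseteq> A"
  shows "sq_avg A B x \<le> sq_avg A A x"
proof -
  define \<delta> :: "'a \<Rightarrow> real" where "\<delta> i = (if i \<in> B then 1 else -1)" for i
  have "(\<Sum>i\<in>B. \<epsilon> i *\<^sub>R x i) = (1/2) *\<^sub>R ((\<Sum>i\<in>A. \<epsilon> i *\<^sub>R x i) + (\<Sum>i\<in>A. (\<delta> i * \<epsilon> i) *\<^sub>R x i))" for \<epsilon>
  proof -
    have "(\<Sum>i\<in>A. \<epsilon> i *\<^sub>R x i) + (\<Sum>i\<in>A. (\<delta> i * \<epsilon> i) *\<^sub>R x i) = (\<Sum>i\<in>A. if i \<in> B then 2 *\<^sub>R \<epsilon> i *\<^sub>R x i else 0)"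
      unfolding sum.distrib[symmetric]
      by (intro sum.cong) (auto simp: \<delta>_def scaleR_2 scaleR_add_left[symmetric])
    also have "\<dots> = (\<Sum>i\<in>B. 2 *\<^sub>R \<epsilon> i *\<^sub>R x i)"
      using assms by (simp add: sum.If_cases Int_absorb1)
    finally show ?thesis by (simp add: scaleR_sum_right)
  qed
  then have "sq_avg A B x \<le> (\<Sum>\<epsilon>\<in>signs A. ((norm (\<Sum>i\<in>A. \<epsilon> i *\<^sub>R x i))\<^sup>2 + (norm (\<Sum>i\<in>A. (\<delta> i * \<epsilon> i) *\<^sub>R x i))\<^sup>2) / 2) / 2 ^ card A"
    unfolding sq_avg_def by (intro divide_right_mono sum_mono) (simp_all only: norm_half_add_sq_le, simp)
  also have "\<dots> = (sq_avg A A x + (\<Sum>\<epsilon>\<in>signs A. (norm (\<Sum>i\<in>A. (\<delta> i * \<epsilon> i) *\<^sub>R x i))\<^sup>2) / 2 ^ card A) / 2"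
    by (simp add: sq_avg_def sum.distrib sum_divide_distrib[symmetric] add_divide_distrib)
  also have "\<dots> = sq_avg A A x"
    using sq_avg_flip[of A A \<delta> x] by (simp add: \<delta>_def)
  finally show ?thesis .
qed

lemma sq_avg_singleton:
  assumes "finite A" "i \<in> A"
  shows "sq_avg A {i} x = (norm (x i))\<^sup>2"
proof -
  have "(norm (\<Sum>i\<in>{i}. \<epsilon> i *\<^sub>R x i))\<^sup>2 = (norm (x i))\<^sup>2" if "\<epsilon> \<in> signs A" for \<epsilon>
    using PiE_mem[OF that assms(2)] by auto
  then have "(\<Sum>\<epsilon>\<in>signs A. (norm (\<Sum>i\<in>{i}. \<epsilon> i *\<^sub>R x i))\<^sup>2) = (\<Sum>\<epsilon>\<in>signs A. (norm (x i))\<^sup>2)"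
    by (rule sum.cong[OF refl])
  then show ?thesis
    using assms(1) unfolding sq_avg_def by (simp only: sum_constant card_signs) simp
qed

lemma norm_sq_le_sq_avg: "finite A \<Longrightarrow> i \<in> A \<Longrightarrow> (norm (x i))\<^sup>2 \<le> sq_avg A A x"
  using sq_avg_mono[of A "{i}" x] by (simp add: sq_avg_singleton)

text \<open>The signs are invariant under multiplication by \<open>\<delta> (l i)\<close>, so the assumption can be applied
  to the block sums for each fixed choice of signs inside the blocks.\<close>

lemma sq_avg_blocks:
  fixes x :: "'i \<Rightarrow> 'b::real_normed_vector"
  assumes gain: "\<And>y :: nat \<Rightarrow> 'b. (\<Sum>j<n. (norm (y j))\<^sup>2) \<le> c * sq_avg {..<n} {..<n} y"
    and "finite A" "B \<subseteq> A" and l: "\<And>i. i \<in> B \<Longrightarrow> l i < n"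
  shows "(\<Sum>j<n. sq_avg A {i \<in> B. l i = j} x) \<le> c * sq_avg A B x"
proof -
  define y where "y \<epsilon> j = (\<Sum>i\<in>{i \<in> B. l i = j}. \<epsilon> i *\<^sub>R x i)" for \<epsilon> j
  define D where "D = signs {..<n}"
  have fin: "finite B" using assms finite_subset by blast
  have D: "card D = 2 ^ n" unfolding D_def by (simp add: card_signs)
  have merge: "(\<Sum>j<n. \<delta> j *\<^sub>R y \<epsilon> j) = (\<Sum>i\<in>B. (\<delta> (l i) * \<epsilon> i) *\<^sub>R x i)" for \<delta> \<epsilon>
  proof -
    have "(\<Sum>j<n. \<delta> j *\<^sub>R y \<epsilon> j) = (\<Sum>j<n. \<Sum>i\<in>{i \<in> B. l i = j}. (\<delta> (l i) * \<epsilon> i) *\<^sub>R x i)"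
      unfolding y_def scaleR_sum_right by (intro sum.cong) auto
    also have "\<dots> = (\<Sum>i\<in>B. (\<delta> (l i) * \<epsilon> i) *\<^sub>R x i)"
      by (rule sum.group) (use fin l in auto)
    finally show ?thesis .
  qed
  have flip: "(\<Sum>\<epsilon>\<in>signs A. (norm (\<Sum>j<n. \<delta> j *\<^sub>R y \<epsilon> j))\<^sup>2) / 2 ^ card A = sq_avg A B x" if "\<delta> \<in> D" for \<delta>
  proof -
    define \<delta>' where "\<delta>' i = (if i \<in> B then \<delta> (l i) else 1)" for i
    have "\<delta>' i \<in> {-1, 1}" for i
      using that l by (auto simp: D_def \<delta>'_def PiE_iff)
    moreover have "(\<Sum>i\<in>B. (\<delta> (l i) * \<epsilon> i) *\<^sub>R x i) = (\<Sum>i\<in>B. (\<delta>' i * \<epsilon> i) *\<^sub>R x i)" for \<epsilon>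
      by (intro sum.cong) (auto simp: \<delta>'_def)
    ultimately show ?thesis
      unfolding merge using sq_avg_flip[OF assms(3), of \<delta>' x] by simp
  qed
  have "(\<Sum>j<n. sq_avg A {i \<in> B. l i = j} x) = (\<Sum>\<epsilon>\<in>signs A. \<Sum>j<n. (norm (y \<epsilon> j))\<^sup>2) / 2 ^ card A"
    unfolding sq_avg_def y_def sum_divide_distrib[symmetric] by (subst sum.swap) simp
  also have "\<dots> \<le> (\<Sum>\<epsilon>\<in>signs A. c * ((\<Sum>\<delta>\<in>D. (norm (\<Sum>j<n. \<delta> j *\<^sub>R y \<epsilon> j))\<^sup>2) / 2 ^ n)) / 2 ^ card A"
    using gain by (intro divide_right_mono sum_mono) (auto simp: sq_avg_def D_def)
  also have "\<dots> = c * ((\<Sum>\<epsilon>\<in>signs A. \<Sum>\<delta>\<in>D. (norm (\<Sum>j<n. \<delta> j *\<^sub>R y \<epsilon> j))\<^sup>2) / 2 ^ card A / 2 ^ n)"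
    by (simp add: sum_distrib_left sum_divide_distrib field_simps)
  also have "\<dots> = c * ((\<Sum>\<delta>\<in>D. (\<Sum>\<epsilon>\<in>signs A. (norm (\<Sum>j<n. \<delta> j *\<^sub>R y \<epsilon> j))\<^sup>2) / 2 ^ card A) / 2 ^ n)"
    by (subst sum.swap) (simp add: sum_divide_distrib)
  also have "\<dots> = c * sq_avg A B x"
    by (simp add: flip D)
  finally show ?thesis .
qed

section \<open>Iterated gain and finite cotype\<close>

lemma card_div_eq:
  fixes m :: nat assumes "j < n" "0 < m"
  shows "card {v. v < n * m \<and> v div m = j} = m"
proof -
  have "{v. v < n * m \<and> v div m = j} = {j * m..<Suc j * m}"
  proof (intro equalityI subsetI)
    fix v assume v: "v \<in> {j * m..<Suc j * m}"
    have "Suc j * m \<le> n * m" using assms by (intro mult_right_mono) auto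
    moreover have "v div m = j"
      using v by (intro div_nat_eqI) (auto simp: mult.commute)
    ultimately show "v \<in> {v. v < n * m \<and> v div m = j}" using v by auto
  next
    fix v assume "v \<in> {v. v < n * m \<and> v div m = j}"
    then show "v \<in> {j * m..<Suc j * m}"
      using assms by (auto simp: mult.commute dividend_less_times_div)
  qed
  then show ?thesis by simp
qed

text \<open>Induction on \<open>k\<close>: \<open>B\<close> is cut into \<open>n\<close> classes of
  size \<open>n ^ k\<close>, the induction hypothesis treats each class, and
  \<open>sq_avg_blocks\<close> contributes one more factor \<open>c\<close>.\<close>

lemma sum_norm_sq_le_sq_avg_power:
  fixes x :: "'i \<Rightarrow> 'b::real_normed_vector"
  assumes gain: "\<And>y :: nat \<Rightarrow> 'b. (\<Sum>j<n. (norm (y j))\<^sup>2) \<le> c * sq_avg {..<n} {..<n} y"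
    and "0 \<le> c" "0 < n" "finite A"
  shows "B \<subseteq> A \<Longrightarrow> card B = n ^ k \<Longrightarrow> (\<Sum>i\<in>B. (norm (x i))\<^sup>2) \<le> c ^ k * sq_avg A B x"
proof (induction k arbitrary: B)
  case 0
  then obtain i where "B = {i}" by (auto simp: card_1_singleton_iff)
  with 0 assms show ?case by (simp add: sq_avg_singleton)
next
  case (Suc k)
  have finB: "finite B" using Suc assms finite_subset by blast
  obtain h where h: "bij_betw h B {0..<card B}" using ex_bij_betw_finite_nat[OF finB] by auto
  define l where "l i = h i div n ^ k" for i
  have l: "l i < n" if "i \<in> B" for i
    using bij_betwE[OF h] that Suc.prems(2) assms(3)
    by (auto simp: l_def less_mult_imp_div_less)
  have "card {i \<in> B. l i = j} = n ^ k" if "j < n" for j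
  proof -
    have "bij_betw h {i \<in> B. l i = j} {v. v < n * n ^ k \<and> v div n ^ k = j}"
      unfolding bij_betw_def
    proof
      show "inj_on h {i \<in> B. l i = j}"
        using h by (auto simp: bij_betw_def inj_on_def)
      show "h ` {i \<in> B. l i = j} = {v. v < n * n ^ k \<and> v div n ^ k = j}"
        using bij_betw_imp_surj_on[OF h] Suc.prems(2) by (force simp: l_def)
    qed
    then have "card {i \<in> B. l i = j} = card {v. v < n * n ^ k \<and> v div n ^ k = j}"
      by (rule bij_betw_same_card)
    then show ?thesis using card_div_eq[OF that] assms(3) by simp
  qed
  then have "(\<Sum>i\<in>{i \<in> B. l i = j}. (norm (x i))\<^sup>2) \<le> c ^ k * sq_avg A {i \<in> B. l i = j} x" if "j < n" for j
    using Suc.prems(1) that by (intro Suc.IH) auto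
  then have "(\<Sum>j<n. \<Sum>i\<in>{i \<in> B. l i = j}. (norm (x i))\<^sup>2) \<le> c ^ k * (\<Sum>j<n. sq_avg A {i \<in> B. l i = j} x)"
    by (auto simp: sum_distrib_left intro: sum_mono)
  also have "\<dots> \<le> c ^ k * (c * sq_avg A B x)"
    using sq_avg_blocks[OF gain assms(4) Suc.prems(1) l] assms(2) by (intro mult_left_mono) auto
  also have "(\<Sum>j<n. \<Sum>i\<in>{i \<in> B. l i = j}. (norm (x i))\<^sup>2) = (\<Sum>i\<in>B. (norm (x i))\<^sup>2)"
    by (rule sum.group) (use finB l in auto)
  finally show ?case by (simp add: mult_ac)
qed

text \<open>Removing an index that witnesses the bound for the current set, and repeating, charges
  each \<open>h m\<close> with \<open>m\<close> up to \<open>card A\<close> exactly once.\<close>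

lemma sum_le_of_min_le:
  fixes w :: "'i \<Rightarrow> real"
  assumes "finite A" "\<And>B. B \<subseteq> A \<Longrightarrow> B \<noteq> {} \<Longrightarrow> \<exists>i\<in>B. w i \<le> h (card B)"
  shows "sum w A \<le> (\<Sum>m=1..card A. h m)"
  using assms
proof (induction "card A" arbitrary: A)
  case 0
  then show ?case by simp
next
  case (Suc k)
  then obtain i where i: "i \<in> A" "w i \<le> h (card A)"
    by (metis card.empty nat.distinct(1) subset_refl)
  have "sum w A = w i + sum w (A - {i})"
    using i Suc.prems by (simp add: sum.remove)
  also have "sum w (A - {i}) \<le> (\<Sum>m=1..card (A - {i}). h m)"
    using Suc.prems Suc.hyps(2) i by (intro Suc.hyps(1)) auto
  also have "w i + \<dots> \<le> h (Suc k) + (\<Sum>m=1..k. h m)"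
    using i Suc.hyps(2)[symmetric] Suc.prems by simp
  also have "\<dots> = (\<Sum>m=1..card A. h m)"
    using Suc.hyps(2)[symmetric] by simp
  finally show ?case by simp
qed

lemma sum_inverse_squares_le: "(\<Sum>m=1..n. 1 / (real m)\<^sup>2) \<le> 2"
proof -
  have "(\<Sum>m=1..Suc n. 1 / (real m)\<^sup>2) \<le> 2 - 1 / real (Suc n)" for n
  proof (induction n)
    case (Suc n)
    have "1 / (real (Suc (Suc n)))\<^sup>2 \<le> 1 / (real (Suc n) * real (Suc (Suc n)))"
      unfolding power2_eq_square by (intro divide_left_mono mult_right_mono) auto
    also have "\<dots> = 1 / real (Suc n) - 1 / real (Suc (Suc n))"
      by (simp add: field_simps)
    finally show ?case using Suc by simp
  qed simp
  moreover have "2 - 1 / real (Suc n) \<le> 2" for n by simp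
  ultimately have "(\<Sum>m=1..Suc n. 1 / (real m)\<^sup>2) \<le> 2" for n
    by (rule order_trans)
  then show ?thesis by (cases n) (simp_all del: sum.cl_ivl_Suc)
qed

text \<open>The constant \<open>n\<close> always works, so \<open>c < n\<close> is a genuine gain.
  Among any \<open>m\<close> vectors one has squared norm at most about
  \<open>m powr - \<rho>\<close> times the average; for large \<open>q\<close> the
  \<open>q\<close>-th powers decay like \<open>1 / m\<^sup>2\<close> and have a bounded sum.\<close>

lemma has_cotype_of_gain:
  fixes c :: real
  assumes gain: "\<And>y :: nat \<Rightarrow> 'b::real_normed_vector.
      (\<Sum>j<n. (norm (y j))\<^sup>2) \<le> c * sq_avg {..<n} {..<n} y"
    and "2 \<le> n" "c < n"
  shows "\<exists>q\<ge>2. has_cotype TYPE('b) q"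
proof -
  \<comment> \<open>Raising \<open>c\<close> to at least \<open>1\<close> gives \<open>d / n\<close>
    a logarithm; \<open>d < n\<close> survives because \<open>2 \<le> n\<close>.\<close>
  define d where "d = max c 1"
  have d: "1 \<le> d" "d < n" using assms by (auto simp: d_def)
  have gain': "(\<Sum>j<n. (norm (y j))\<^sup>2) \<le> d * sq_avg {..<n} {..<n} y" for y :: "nat \<Rightarrow> 'b"
    using gain[of y] mult_right_mono[of c d "sq_avg {..<n} {..<n} y"] sq_avg_nonneg[of "{..<n}" "{..<n}" y]
    by (auto simp: d_def)
  define \<rho> where "\<rho> = - ln (d / n) / ln n"
  have ln_n: "ln (real n) > 0" using assms(2) by simp
  have \<rho>: "\<rho> > 0"
    unfolding \<rho>_def using ln_n d assms(2) by (intro divide_pos_pos) (auto simp: ln_div)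
  have \<theta>: "d / n = n powr - \<rho>"
    unfolding \<rho>_def powr_def using ln_n d assms(2) by auto
  \<comment> \<open>The power \<open>2 / \<rho>\<close> turns the decay
    \<open>m powr - \<rho>\<close> of squared norms into \<open>1 / m\<^sup>2\<close>.\<close>
  define q where "q = max 2 (4 / \<rho>)"
  have q: "q \<ge> 2" "q / 2 \<ge> 2 / \<rho>" by (auto simp: q_def)
  have "(\<Sum>i<N. norm (x i) powr q) powr (1 / q) \<le> (2 * (real n)\<^sup>2) powr (1 / q) * sqrt (sq_avg {..<N} {..<N} x)"
    for N and x :: "nat \<Rightarrow> 'b"
  proof -
    define A where "A = {..<N}"
    define S where "S = sq_avg A A x"
    have A: "finite A" by (simp add: A_def)
    have S: "0 \<le> S" by (simp add: S_def sq_avg_nonneg)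
    have "\<exists>i\<in>B. norm (x i) powr q \<le> S powr (q / 2) * ((real n)\<^sup>2 * (1 / (real (card B))\<^sup>2))"
      if B: "B \<subseteq> A" "B \<noteq> {}" for B
    proof -
      define m where "m = card B"
      have "m \<ge> 1" using B A by (simp add: m_def Suc_le_eq card_gt_0_iff finite_subset)
      \<comment> \<open>Rounding \<open>m\<close> down to a power of \<open>n\<close> loses at most
        a factor \<open>n\<close>, which becomes the \<open>n\<^sup>2\<close> of the claimed
        bound.\<close>
      then obtain k where k: "n ^ k \<le> m" "m < n ^ (k + 1)"
        using ex_power_ivl1[OF assms(2)] by blast
      obtain B' where B': "B' \<subseteq> B" "card B' = n ^ k"
        using obtain_subset_with_card_n[of "n ^ k" B] k(1) by (auto simp: m_def)
      have "(\<Sum>i\<in>B'. (norm (x i))\<^sup>2) \<le> d ^ k * sq_avg A B' x"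
        using B' B A d assms(2) by (intro sum_norm_sq_le_sq_avg_power[OF gain']) auto
      also have "\<dots> \<le> d ^ k * S"
        unfolding S_def using B' B A d by (intro mult_left_mono sq_avg_mono) auto
      finally have le: "(\<Sum>i\<in>B'. (norm (x i))\<^sup>2) \<le> d ^ k * S" .
      have "\<exists>i\<in>B'. (norm (x i))\<^sup>2 \<le> (d / n) ^ k * S"
      proof (rule ccontr)
        assume "\<not> ?thesis"
        then have "(\<Sum>i\<in>B'. (norm (x i))\<^sup>2) > (\<Sum>i\<in>B'. (d / n) ^ k * S)"
          using B' assms(2) by (intro sum_strict_mono) (auto intro: card_ge_0_finite simp: card_gt_0_iff)
        then show False using le B' assms(2) by (simp add: power_divide)
      qed
      then obtain i where i: "i \<in> B'" "(norm (x i))\<^sup>2 \<le> (d / n) ^ k * S" by blast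
      have iA: "(norm (x i))\<^sup>2 \<le> S" using i B' B A by (auto simp: S_def intro!: norm_sq_le_sq_avg)
      have "norm (x i) powr q \<le> S powr (q / 2) * ((real n)\<^sup>2 * (1 / (real m)\<^sup>2))"
      proof (cases "S = 0")
        case True
        then show ?thesis using iA q by simp
      next
        case False
        with S have S: "S > 0" by simp
        define a where "a = (norm (x i))\<^sup>2 / S"
        have a: "0 \<le> a" "a \<le> 1" using S iA by (auto simp: a_def)
        have "a \<le> (d / n) ^ k" using i(2) S by (simp add: a_def field_simps)
        also have "\<dots> = (real n ^ k) powr - \<rho>"
          unfolding \<theta> using assms(2) by (simp add: powr_powr[symmetric] powr_realpow[symmetric] powr_powr mult.commute)
        also have "\<dots> \<le> (real m / n) powr - \<rho>"
        proof (rule powr_mono2')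
          have "real m \<le> real (n ^ (k + 1))" using k(2) by linarith
          then show "real m / n \<le> real n ^ k" using assms(2) by (simp add: field_simps)
        qed (use \<open>m \<ge> 1\<close> assms(2) \<rho> in auto)
        also have "\<dots> = (n / real m) powr \<rho>"
          using \<open>m \<ge> 1\<close> assms(2) by (simp add: powr_minus powr_divide)
        finally have "a powr (2 / \<rho>) \<le> ((n / real m) powr \<rho>) powr (2 / \<rho>)"
          using a \<rho> by (intro powr_mono2) auto
        also have "\<dots> = (n / real m)\<^sup>2"
          using \<rho> \<open>m \<ge> 1\<close> assms(2) by (simp add: powr_powr)
        finally have *: "a powr (q / 2) \<le> (n / real m)\<^sup>2"
          using powr_mono'[OF q(2) a] by linarith
        have "norm (x i) powr q = ((norm (x i))\<^sup>2) powr (q / 2)"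
          by (cases "x i = 0") (simp_all add: powr_powr flip: powr_numeral)
        also have "\<dots> = S powr (q / 2) * a powr (q / 2)"
          using S by (simp add: a_def powr_divide)
        also have "\<dots> \<le> S powr (q / 2) * (n / real m)\<^sup>2"
          using * by (intro mult_left_mono) auto
        finally show ?thesis by (simp add: power_divide)
      qed
      then show ?thesis using i B' by (auto simp: m_def)
    qed
    then have "(\<Sum>i\<in>A. norm (x i) powr q) \<le> (\<Sum>m=1..card A. S powr (q / 2) * ((real n)\<^sup>2 * (1 / (real m)\<^sup>2)))"
      using A by (intro sum_le_of_min_le) auto
    also have "\<dots> = S powr (q / 2) * ((real n)\<^sup>2 * (\<Sum>m=1..card A. 1 / (real m)\<^sup>2))"
      by (simp add: sum_distrib_left)
    also have "\<dots> \<le> S powr (q / 2) * ((real n)\<^sup>2 * 2)"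
      by (intro mult_left_mono sum_inverse_squares_le zero_le_power2 powr_ge_zero)
    finally have "(\<Sum>i\<in>A. norm (x i) powr q) powr (1 / q) \<le> (S powr (q / 2) * (2 * (real n)\<^sup>2)) powr (1 / q)"
      using q by (intro powr_mono2) (auto intro: sum_nonneg simp: mult_ac)
    also have "\<dots> = S powr (1 / 2) * (2 * (real n)\<^sup>2) powr (1 / q)"
      using q by (simp add: powr_mult powr_powr)
    finally show ?thesis
      using S by (simp add: powr_half_sqrt A_def S_def mult.commute)
  qed
  then have "has_cotype TYPE('b) q"
    unfolding has_cotype_def sq_avg_def card_lessThan by blast
  then show ?thesis using q by blast
qed

text \<open>By convexity the norm on a cube of coefficients is largest at the vertices. One
  coefficient at a time is written as a convex combination of \<open>1\<close> and
  \<open>-1\<close>; \<open>v\<close> absorbs the coordinate just fixed.\<close>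

lemma norm_sum_scale_le_signs:
  fixes z :: "'i \<Rightarrow> 'b::real_normed_vector"
  assumes "finite A" "\<And>\<epsilon>. \<epsilon> \<in> signs A \<Longrightarrow> norm (v + (\<Sum>i\<in>A. \<epsilon> i *\<^sub>R z i)) \<le> K"
    and "\<And>i. i \<in> A \<Longrightarrow> \<bar>a i\<bar> \<le> 1"
  shows "norm (v + (\<Sum>i\<in>A. a i *\<^sub>R z i)) \<le> K"
  using assms
proof (induction A arbitrary: v rule: finite_induct)
  case empty
  then show ?case by simp
next
  case (insert j A)
  define w where "w = (\<Sum>i\<in>A. a i *\<^sub>R z i)"
  have "norm ((v + s *\<^sub>R z j) + w) \<le> K" if "s \<in> {-1, 1}" for s
    unfolding w_def
  proof (rule insert.IH)
    fix \<epsilon> assume \<epsilon>: "\<epsilon> \<in> signs A"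
    have "\<epsilon>(j := s) \<in> signs (insert j A)"
      using PiE_fun_upd[OF that \<epsilon>] .
    from insert.prems(1)[OF this]
    have "norm (v + (s *\<^sub>R z j + (\<Sum>i\<in>A. (\<epsilon>(j := s)) i *\<^sub>R z i))) \<le> K"
      using insert.hyps by simp
    moreover have "(\<Sum>i\<in>A. (\<epsilon>(j := s)) i *\<^sub>R z i) = (\<Sum>i\<in>A. \<epsilon> i *\<^sub>R z i)"
      using insert.hyps by (intro sum.cong) auto
    ultimately show "norm (v + s *\<^sub>R z j + (\<Sum>i\<in>A. \<epsilon> i *\<^sub>R z i)) \<le> K"
      by (simp add: add.assoc)
  qed (use insert.prems in auto)
  from this[of 1] this[of "-1"] have *: "norm (v + z j + w) \<le> K" "norm (v - z j + w) \<le> K" by auto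
  have aj: "0 \<le> (1 + a j) / 2" "0 \<le> (1 - a j) / 2" using insert.prems(2)[of j] by auto
  have "v + (a j *\<^sub>R z j + w) = ((1 + a j) / 2) *\<^sub>R (v + z j + w) + ((1 - a j) / 2) *\<^sub>R (v - z j + w)"
  proof -
    have "((1 + a j) / 2) *\<^sub>R (v + z j + w) + ((1 - a j) / 2) *\<^sub>R (v - z j + w)
        = ((1 + a j) / 2 + (1 - a j) / 2) *\<^sub>R (v + w) + ((1 + a j) / 2 - (1 - a j) / 2) *\<^sub>R z j"
      unfolding scaleR_add_left scaleR_diff_left by (simp add: algebra_simps)
    also have "\<dots> = 1 *\<^sub>R (v + w) + a j *\<^sub>R z j"
      by (intro arg_cong2[where f = "(+)"] arg_cong2[where f = scaleR] refl) (auto simp: field_simps)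
    finally show ?thesis by (simp add: algebra_simps)
  qed
  also have "norm \<dots> \<le> ((1 + a j) / 2) * norm (v + z j + w) + ((1 - a j) / 2) * norm (v - z j + w)"
    using aj by (intro order_trans[OF norm_triangle_ineq]) auto
  also have "\<dots> \<le> ((1 + a j) / 2) * K + ((1 - a j) / 2) * K"
    using aj * by (intro add_mono mult_left_mono) auto
  also have "\<dots> = K" by (simp add: field_simps)
  finally show ?case using insert.hyps by (simp add: w_def)
qed

section \<open>Copies of finite-dimensional sup-norm spaces\<close>

text \<open>If the second moment of the norm of the signed sums exceeds its lower bound by little, then the
  norm has small variance; with respect to the \<open>2 ^ n\<close>-point uniform distribution this forces
  all its values to be close to \<open>1\<close>.\<close>

lemma exists_almost_extremal:
  assumes "without_cotype TYPE('b::real_normed_vector)" "2 \<le> n"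
  shows "\<exists>z :: nat \<Rightarrow> 'b. (\<forall>i<n. 7/8 \<le> norm (z i)) \<and>
    (\<forall>\<epsilon>\<in>signs {..<n}. norm (\<Sum>i<n. \<epsilon> i *\<^sub>R z i) \<le> 5/4)"
proof -
  define A where "A = {..<n}"
  have A: "finite A" "card A = n" by (auto simp: A_def)
  \<comment> \<open>With this deficit the squared deviations of the signed norms from
    \<open>1\<close> sum to at most \<open>2 * 2 ^ n * \<kappa> = 1/16\<close>, hence the bound
    \<open>5/4\<close>.\<close>
  define \<kappa> :: real where "\<kappa> = 1 / (32 * 2 ^ n)"
  have "(1::real) \<le> 2 ^ n" by simp
  then have \<kappa>: "0 < \<kappa>" "\<kappa> \<le> 1/32" by (auto simp: \<kappa>_def field_simps)
  obtain y :: "nat \<Rightarrow> 'b" where y: "(n - \<kappa>) * sq_avg A A y < (\<Sum>j\<in>A. (norm (y j))\<^sup>2)"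
  proof -
    have "\<not> (\<forall>y :: nat \<Rightarrow> 'b. (\<Sum>j<n. (norm (y j))\<^sup>2) \<le> (n - \<kappa>) * sq_avg {..<n} {..<n} y)"
      using has_cotype_of_gain[where 'b = 'b and n = n and c = "n - \<kappa>"] assms \<kappa>(1)
      unfolding without_cotype_def by auto
    then show ?thesis using that by (auto simp: A_def not_le)
  qed
  define S where "S = sq_avg A A y"
  have le_S: "(norm (y j))\<^sup>2 \<le> S" if "j \<in> A" for j
    using norm_sq_le_sq_avg[OF A(1) that] by (simp add: S_def)
  have "S \<noteq> 0"
  proof
    assume "S = 0"
    then have "(\<Sum>j\<in>A. (norm (y j))\<^sup>2) = 0" using le_S by (intro sum.neutral) force
    with y \<open>S = 0\<close> show False by (simp add: S_def)
  qed
  then have S: "S > 0" using sq_avg_nonneg[of A A y] by (simp add: S_def)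
  define z where "z j = (1 / sqrt S) *\<^sub>R y j" for j
  \<comment> \<open>The other \<open>n - 1\<close> terms are at most \<open>S\<close> each, so
    near-equality in \<open>y\<close> forces this one to be near \<open>S\<close> too.\<close>
  have large: "1 - \<kappa> \<le> norm (z j)" if j: "j \<in> A" for j
  proof -
    have "(\<Sum>i\<in>A - {j}. (norm (y i))\<^sup>2) \<le> (real n - 1) * S"
      using sum_bounded_above[of "A - {j}" "\<lambda>i. (norm (y i))\<^sup>2" S] le_S A j assms(2)
      by (simp add: of_nat_diff)
    moreover have "(\<Sum>i\<in>A. (norm (y i))\<^sup>2) = (norm (y j))\<^sup>2 + (\<Sum>i\<in>A - {j}. (norm (y i))\<^sup>2)"
      using A j by (simp add: sum.remove)
    ultimately have "(1 - \<kappa>) * S \<le> (norm (y j))\<^sup>2"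
      using y by (simp add: S_def algebra_simps)
    then have "1 - \<kappa> \<le> (norm (y j))\<^sup>2 / S" using S by (simp add: field_simps)
    also have "\<dots> = (norm (z j))\<^sup>2" using S by (simp add: z_def power_divide)
    finally have "1 - \<kappa> \<le> (norm (z j))\<^sup>2" .
    moreover have "(1 - \<kappa>)\<^sup>2 \<le> 1 - \<kappa>" using \<kappa> by (simp add: power2_eq_square algebra_simps)
    ultimately have "(1 - \<kappa>)\<^sup>2 \<le> (norm (z j))\<^sup>2" by simp
    then show ?thesis by (rule power2_le_imp_le) simp
  qed
  define f where "f \<epsilon> = norm (\<Sum>i\<in>A. \<epsilon> i *\<^sub>R z i)" for \<epsilon>
  have f: "(f \<epsilon>)\<^sup>2 = (norm (\<Sum>i\<in>A. \<epsilon> i *\<^sub>R y i))\<^sup>2 / S" for \<epsilon>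
  proof -
    have "(\<Sum>i\<in>A. \<epsilon> i *\<^sub>R z i) = (1 / sqrt S) *\<^sub>R (\<Sum>i\<in>A. \<epsilon> i *\<^sub>R y i)"
      by (simp add: z_def scaleR_sum_right mult.commute)
    then show ?thesis using S by (simp add: f_def power_divide)
  qed
  have sum_f2: "(\<Sum>\<epsilon>\<in>signs A. (f \<epsilon>)\<^sup>2) = 2 ^ n"
    unfolding f sum_divide_distrib[symmetric]
    using S by (simp add: S_def sq_avg_def A(2) field_simps)
  have "2 ^ n * (1 - \<kappa>) \<le> (\<Sum>\<epsilon>\<in>signs A. f \<epsilon>)"
  proof -
    have 0: "0 \<in> A" using assms(2) by (simp add: A_def)
    \<comment> \<open>Only the sign at \<open>0\<close> is kept. A signed sum and its flip add up to
      twice \<open>\<epsilon> 0 *\<^sub>R z 0\<close>, which bounds the mean of \<open>f\<close>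
      from below.\<close>
    define \<delta> :: "nat \<Rightarrow> real" where "\<delta> i = (if i = 0 then 1 else -1)" for i
    have "2 * (1 - \<kappa>) \<le> f \<epsilon> + f (\<lambda>i\<in>A. \<delta> i * \<epsilon> i)" if \<epsilon>: "\<epsilon> \<in> signs A" for \<epsilon>
    proof -
      have "(\<Sum>i\<in>A. \<epsilon> i *\<^sub>R z i) + (\<Sum>i\<in>A. (\<lambda>i\<in>A. \<delta> i * \<epsilon> i) i *\<^sub>R z i) = (\<Sum>i\<in>A. if i = 0 then \<epsilon> i *\<^sub>R z i + \<epsilon> i *\<^sub>R z i else 0)"
        unfolding sum.distrib[symmetric] by (intro sum.cong) (auto simp: \<delta>_def)
      also have "\<dots> = \<epsilon> 0 *\<^sub>R z 0 + \<epsilon> 0 *\<^sub>R z 0" using 0 A by simp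
      also have "\<dots> = 2 *\<^sub>R \<epsilon> 0 *\<^sub>R z 0" by (rule scaleR_2[symmetric])
      finally have "norm (2 *\<^sub>R \<epsilon> 0 *\<^sub>R z 0) \<le> f \<epsilon> + f (\<lambda>i\<in>A. \<delta> i * \<epsilon> i)"
        unfolding f_def by (metis norm_triangle_ineq)
      moreover have "\<bar>\<epsilon> 0\<bar> = 1" using PiE_mem[OF \<epsilon> 0] by auto
      ultimately show ?thesis using large[OF 0] by (simp add: abs_mult)
    qed
    then have "(\<Sum>\<epsilon>\<in>signs A. 2 * (1 - \<kappa>)) \<le> (\<Sum>\<epsilon>\<in>signs A. f \<epsilon> + f (\<lambda>i\<in>A. \<delta> i * \<epsilon> i))"
      by (rule sum_mono)
    also have "\<dots> = 2 * (\<Sum>\<epsilon>\<in>signs A. f \<epsilon>)"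
      using sum_signs_flip[of A \<delta> f] by (simp add: sum.distrib \<delta>_def)
    finally show ?thesis by (simp add: card_signs A algebra_simps)
  qed
  moreover have "(\<Sum>\<epsilon>\<in>signs A. (f \<epsilon> - 1)\<^sup>2) = (\<Sum>\<epsilon>\<in>signs A. (f \<epsilon>)\<^sup>2) - 2 * (\<Sum>\<epsilon>\<in>signs A. f \<epsilon>) + 2 ^ n"
    by (simp add: power2_diff sum.distrib sum_subtractf sum_distrib_left card_signs A)
  ultimately have var: "(\<Sum>\<epsilon>\<in>signs A. (f \<epsilon> - 1)\<^sup>2) \<le> 1 / 16"
    using sum_f2 by (simp add: \<kappa>_def algebra_simps)
  have "f \<epsilon> \<le> 5/4" if \<epsilon>: "\<epsilon> \<in> signs A" for \<epsilon>
  proof -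
    have "(f \<epsilon> - 1)\<^sup>2 \<le> (\<Sum>\<epsilon>\<in>signs A. (f \<epsilon> - 1)\<^sup>2)"
      using \<epsilon> A by (intro member_le_sum) (auto intro: finite_PiE)
    with var have "(f \<epsilon> - 1)\<^sup>2 \<le> (1/4)\<^sup>2" by (simp add: power2_eq_square)
    then have "f \<epsilon> - 1 \<le> 1/4" by (rule power2_le_imp_le) simp
    then show ?thesis by simp
  qed
  moreover have "7/8 \<le> norm (z j)" if "j \<in> A" for j
    using large[OF that] \<kappa> by linarith
  ultimately show ?thesis unfolding f_def A_def by blast
qed

text \<open>Equivalence with the unit vector basis of a sup-norm space, with constants
  \<open>1\<close> and \<open>3\<close>. Quantifying over \<open>t\<close> instead of taking a
  maximum avoids a special case for empty \<open>I\<close>.\<close>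

definition linf_basis :: "'i set \<Rightarrow> ('i \<Rightarrow> 'b::real_normed_vector) \<Rightarrow> bool" where
  "linf_basis I z \<longleftrightarrow>
     (\<forall>a t. 0 \<le> t \<longrightarrow> (\<forall>i\<in>I. \<bar>a i\<bar> \<le> t) \<longrightarrow> norm (\<Sum>i\<in>I. a i *\<^sub>R z i) \<le> 3 * t) \<and>
     (\<forall>a. \<forall>i\<in>I. \<bar>a i\<bar> \<le> norm (\<Sum>i\<in>I. a i *\<^sub>R z i))"

lemma linf_basis_upper:
  "linf_basis I z \<Longrightarrow> 0 \<le> t \<Longrightarrow> (\<And>i. i \<in> I \<Longrightarrow> \<bar>a i\<bar> \<le> t) \<Longrightarrow> norm (\<Sum>i\<in>I. a i *\<^sub>R z i) \<le> 3 * t"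
  by (simp add: linf_basis_def)

lemma linf_basis_lower:
  "linf_basis I z \<Longrightarrow> i \<in> I \<Longrightarrow> \<bar>a i\<bar> \<le> norm (\<Sum>i\<in>I. a i *\<^sub>R z i)"
  by (simp add: linf_basis_def)

text \<open>The lower estimate is the triangle inequality for the sum of \<open>\<Sum>a\<^sub>i z\<^sub>i\<close> and the vector obtained by
  changing the sign of all coefficients except the largest one.\<close>

lemma linf_basis_of_signs:
  fixes z :: "'i \<Rightarrow> 'b::real_normed_vector"
  assumes A: "finite A" and large: "\<And>i. i \<in> A \<Longrightarrow> 7/8 \<le> norm (z i)"
    and small: "\<And>\<epsilon>. \<epsilon> \<in> signs A \<Longrightarrow> norm (\<Sum>i\<in>A. \<epsilon> i *\<^sub>R z i) \<le> 5/4"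
  shows "linf_basis A (\<lambda>i. 2 *\<^sub>R z i)"
proof -
  have upper: "norm (\<Sum>i\<in>A. a i *\<^sub>R z i) \<le> 5/4 * t"
    if t: "0 \<le> t" "\<And>i. i \<in> A \<Longrightarrow> \<bar>a i\<bar> \<le> t" for a t
  proof (cases "t = 0")
    case True
    then show ?thesis using t by simp
  next
    case False
    with t(1) have "t > 0" by simp
    have "norm (0 + (\<Sum>i\<in>A. (a i / t) *\<^sub>R z i)) \<le> 5/4"
    proof (rule norm_sum_scale_le_signs[OF A])
      show "norm (0 + (\<Sum>i\<in>A. \<epsilon> i *\<^sub>R z i)) \<le> 5/4" if "\<epsilon> \<in> signs A" for \<epsilon>
        using small[OF that] by simp
      show "\<bar>a i / t\<bar> \<le> 1" if "i \<in> A" for i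
        using t(2)[OF that] \<open>t > 0\<close> by simp
    qed
    moreover have "(\<Sum>i\<in>A. a i *\<^sub>R z i) = t *\<^sub>R (\<Sum>i\<in>A. (a i / t) *\<^sub>R z i)"
      using \<open>t > 0\<close> by (simp add: scaleR_sum_right)
    ultimately show ?thesis using \<open>t > 0\<close> by (simp add: mult.commute)
  qed
  have lower: "\<bar>a i\<bar> \<le> 2 * norm (\<Sum>i\<in>A. a i *\<^sub>R z i)" if i: "i \<in> A" for a i
  proof -
    define t where "t = Max ((\<lambda>i. \<bar>a i\<bar>) ` A)"
    have "t \<in> (\<lambda>i. \<bar>a i\<bar>) ` A" unfolding t_def using A i by (intro Max_in) auto
    then obtain k where k: "k \<in> A" "t = \<bar>a k\<bar>" by auto
    have t: "\<bar>a j\<bar> \<le> t" if "j \<in> A" for j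
      unfolding t_def using A that by (intro Max_ge) auto
    define b where "b j = (if j = k then a k else - a j)" for j
    have "(\<Sum>j\<in>A. a j *\<^sub>R z j) + (\<Sum>j\<in>A. b j *\<^sub>R z j) = (\<Sum>j\<in>A. if j = k then a j *\<^sub>R z j + a j *\<^sub>R z j else 0)"
      unfolding sum.distrib[symmetric] by (intro sum.cong) (auto simp: b_def)
    also have "\<dots> = a k *\<^sub>R z k + a k *\<^sub>R z k" using k A by simp
    also have "\<dots> = 2 *\<^sub>R a k *\<^sub>R z k" by (rule scaleR_2[symmetric])
    finally have "norm (2 *\<^sub>R a k *\<^sub>R z k) \<le> norm (\<Sum>j\<in>A. a j *\<^sub>R z j) + norm (\<Sum>j\<in>A. b j *\<^sub>R z j)"
      by (metis norm_triangle_ineq)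
    moreover have "norm (\<Sum>j\<in>A. b j *\<^sub>R z j) \<le> 5/4 * t"
      by (rule upper) (use k t in \<open>auto simp: b_def\<close>)
    moreover have "7/8 * t \<le> t * norm (z k)"
      using mult_left_mono[OF large[OF k(1)], of t] k(2) by simp
    \<comment> \<open>Twice \<open>7/8 * t\<close> exceeds \<open>5/4 * t\<close> by
      \<open>t / 2\<close>, whence the factor \<open>2\<close> here and in the rescaled
      basis.\<close>
    ultimately show ?thesis using t[OF i] k(2) by simp
  qed
  have "(\<Sum>i\<in>A. a i *\<^sub>R 2 *\<^sub>R z i) = 2 *\<^sub>R (\<Sum>i\<in>A. a i *\<^sub>R z i)" for a
    by (simp add: scaleR_sum_right mult.commute)
  moreover have "2 * norm (\<Sum>i\<in>A. a i *\<^sub>R z i) \<le> 3 * t"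
    if "0 \<le> t" "\<And>i. i \<in> A \<Longrightarrow> \<bar>a i\<bar> \<le> t" for a t
    using upper[of t a] that by fastforce
  ultimately show ?thesis using lower by (simp add: linf_basis_def)
qed

lemma linf_basis_reindex:
  assumes "bij_betw h I J" "linf_basis J z"
  shows "linf_basis I (z \<circ> h)"
proof -
  define g where "g = the_inv_into I h"
  have g: "g (h i) = i" if "i \<in> I" for i
    unfolding g_def using assms(1) that by (simp add: bij_betw_def the_inv_into_f_f)
  have eq: "(\<Sum>i\<in>I. a i *\<^sub>R (z \<circ> h) i) = (\<Sum>j\<in>J. a (g j) *\<^sub>R z j)" for a
    using sum.reindex_bij_betw[OF assms(1), of "\<lambda>j. a (g j) *\<^sub>R z j"] g by simp
  have J: "J = h ` I" using assms(1) by (simp add: bij_betw_def)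
  show ?thesis
    unfolding linf_basis_def eq
  proof (intro conjI allI impI ballI)
    fix a :: "'a \<Rightarrow> real" and t :: real assume "0 \<le> t" "\<forall>i\<in>I. \<bar>a i\<bar> \<le> t"
    then show "norm (\<Sum>j\<in>J. a (g j) *\<^sub>R z j) \<le> 3 * t"
      by (intro linf_basis_upper[OF assms(2)]) (auto simp: J g)
  next
    fix a :: "'a \<Rightarrow> real" and i assume "i \<in> I"
    then show "\<bar>a i\<bar> \<le> norm (\<Sum>j\<in>J. a (g j) *\<^sub>R z j)"
      using linf_basis_lower[OF assms(2), of "h i" "\<lambda>j. a (g j)"] by (simp add: J g)
  qed
qed

lemma linf_basis_subset:
  assumes "finite I" "J \<subseteq> I" "linf_basis I z"
  shows "linf_basis J z"
proof -
  define b where "b a i = (if i \<in> J then a i else 0)" for a :: "'a \<Rightarrow> real" and i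
  have eq: "(\<Sum>i\<in>J. a i *\<^sub>R z i) = (\<Sum>i\<in>I. b a i *\<^sub>R z i)" for a
    using assms(1,2) by (intro sum.mono_neutral_cong_left) (auto simp: b_def)
  show ?thesis
    unfolding linf_basis_def eq
  proof (intro conjI allI impI ballI)
    fix a :: "'a \<Rightarrow> real" and t :: real assume "0 \<le> t" "\<forall>i\<in>J. \<bar>a i\<bar> \<le> t"
    then show "norm (\<Sum>i\<in>I. b a i *\<^sub>R z i) \<le> 3 * t"
      by (intro linf_basis_upper[OF assms(3)]) (auto simp: b_def)
  next
    fix a :: "'a \<Rightarrow> real" and i assume "i \<in> J"
    then show "\<bar>a i\<bar> \<le> norm (\<Sum>i\<in>I. b a i *\<^sub>R z i)"
      using linf_basis_lower[OF assms(3), of i "b a"] assms(2) by (auto simp: b_def)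
  qed
qed

lemma exists_linf_basis:
  assumes "without_cotype TYPE('b::real_normed_vector)" "finite (I :: 'i set)"
  shows "\<exists>z :: 'i \<Rightarrow> 'b. linf_basis I z"
proof -
  \<comment> \<open>The extremal vectors are supplied for \<open>2 \<le> n\<close>; a smaller
    \<open>I\<close> uses part of the family.\<close>
  define n where "n = max 2 (card I)"
  obtain z :: "nat \<Rightarrow> 'b" where z: "\<forall>i<n. 7/8 \<le> norm (z i)"
    "\<forall>\<epsilon>\<in>signs {..<n}. norm (\<Sum>i<n. \<epsilon> i *\<^sub>R z i) \<le> 5/4"
    using exists_almost_extremal[OF assms(1), of n] by (auto simp: n_def)
  have "linf_basis {..<n} (\<lambda>i. 2 *\<^sub>R z i)"
    by (rule linf_basis_of_signs) (use z in auto)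
  then have "linf_basis {0..<card I} (\<lambda>i. 2 *\<^sub>R z i)"
    by (rule linf_basis_subset[rotated 2]) (auto simp: n_def)
  moreover obtain h where "bij_betw h I {0..<card I}"
    using ex_bij_betw_finite_nat[OF assms(2)] by blast
  ultimately show ?thesis using linf_basis_reindex by blast
qed

text \<open>Among very many disjoint blocks of one big \<open>\<ell>\<^sub>\<infinity>\<close> basis, a failure on each block would by
  the pigeonhole principle involve nearly the same \<open>e\<close> for more than \<open>m\<close> blocks. Averaging the
  corresponding vectors leaves \<open>e\<close> unchanged but shrinks the block vectors to size \<open>O(1/m)\<close>.\<close>

lemma exists_linf_basis_away_from_compact:
  fixes K :: "'b::real_normed_vector set" and I :: "'i set"
  assumes "without_cotype TYPE('b)" "compact K" "c < 1" "finite I"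
  shows "\<exists>z :: 'i \<Rightarrow> 'b. linf_basis I z \<and>
    (\<forall>e\<in>K. norm e = 1 \<longrightarrow> (\<forall>a. c \<le> norm (e + (\<Sum>i\<in>I. a i *\<^sub>R z i))))"
proof (rule ccontr)
  assume contra: "\<not> ?thesis"
  \<comment> \<open>Two points of one ball differ by less than \<open>(1 - c) / 2\<close>, so
    exchanging them weakens the bound \<open>c\<close> only to
    \<open>(1 + c) / 2 < 1\<close>.\<close>
  define \<delta> where "\<delta> = (1 - c) / 4"
  have "\<delta> > 0" using assms(3) by (simp add: \<delta>_def)
  then obtain T where T: "finite T" "K \<subseteq> (\<Union>t\<in>T. ball t \<delta>)"
    using assms(2) unfolding compact_eq_totally_bounded by blast
  \<comment> \<open>As \<open>L\<close> exceeds \<open>card T * m\<close>, some ball receives more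
    than \<open>m\<close> blocks; the averaged estimate below allows at most
    \<open>12 / (1 - c)\<close>.\<close>
  obtain m :: nat where m: "12 / (1 - c) < m" using reals_Archimedean2 by blast
  define L where "L = Suc (card T * m)"
  obtain z :: "nat \<times> 'i \<Rightarrow> 'b" where z: "linf_basis ({..<L} \<times> I) z"
    using exists_linf_basis[OF assms(1), of "{..<L} \<times> I"] assms(4) by blast
  have block: "linf_basis I (\<lambda>i. z (j, i))" if "j < L" for j
  proof -
    have "linf_basis ({j} \<times> I) z"
      by (rule linf_basis_subset[OF _ _ z]) (use assms(4) that in auto)
    moreover have "bij_betw (Pair j) I ({j} \<times> I)"
      by (auto simp: bij_betw_def inj_on_def)
    ultimately show ?thesis using linf_basis_reindex by (fastforce simp: comp_def)
  qed
  have "\<forall>j. \<exists>e a. j < L \<longrightarrow> e \<in> K \<and> norm e = 1 \<and> norm (e + (\<Sum>i\<in>I. a i *\<^sub>R z (j, i))) < c"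
    using contra block by (metis not_le)
  then obtain e a where ea: "\<And>j. j < L \<Longrightarrow> e j \<in> K" "\<And>j. j < L \<Longrightarrow> norm (e j) = 1"
      "\<And>j. j < L \<Longrightarrow> norm (e j + (\<Sum>i\<in>I. a j i *\<^sub>R z (j, i))) < c"
    by metis
  define f where "f j = (\<Sum>i\<in>I. a j i *\<^sub>R z (j, i))" for j
  have "\<forall>j. \<exists>t. j < L \<longrightarrow> t \<in> T \<and> e j \<in> ball t \<delta>"
    using ea(1) T(2) by blast
  then obtain \<tau> where \<tau>: "\<And>j. j < L \<Longrightarrow> \<tau> j \<in> T" "\<And>j. j < L \<Longrightarrow> e j \<in> ball (\<tau> j) \<delta>"
    by metis
  have "\<exists>t\<in>T. m < card {j \<in> {..<L}. \<tau> j = t}"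
  proof (rule ccontr)
    assume "\<not> ?thesis"
    then have "(\<Sum>t\<in>T. card {j \<in> {..<L}. \<tau> j = t}) \<le> (\<Sum>t\<in>T. m)"
      by (intro sum_mono) (auto simp: not_less)
    moreover have "(\<Sum>t\<in>T. card {j \<in> {..<L}. \<tau> j = t}) = L"
      using sum.group[of "{..<L}" T \<tau> "\<lambda>_. 1::nat"] T(1) \<tau>(1) by auto
    ultimately show False by (simp add: L_def)
  qed
  then obtain t where t: "m < card {j \<in> {..<L}. \<tau> j = t}" by blast
  define J where "J = {j \<in> {..<L}. \<tau> j = t}"
  have J: "m < card J" "finite J" "J \<subseteq> {..<L}" using t by (auto simp: J_def)
  then obtain j0 where j0: "j0 \<in> J" by fastforce
  have "norm (e j0 + f j) \<le> (1 + c) / 2" if "j \<in> J" for j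
  proof -
    have "dist (e j0) (e j) < \<delta> + \<delta>"
      using \<tau>(2)[of j] \<tau>(2)[of j0] that j0
      by (intro dist_triangle_less_add[where y = t]) (auto simp: J_def dist_commute)
    then have "norm (e j0 - e j) < (1 - c) / 2" by (simp add: dist_norm \<delta>_def)
    moreover have "norm (e j + f j) < c" using ea(3) that J by (auto simp: f_def)
    moreover have "e j0 + f j = (e j0 - e j) + (e j + f j)" by simp
    then have "norm (e j0 + f j) \<le> norm (e j0 - e j) + norm (e j + f j)"
      by (metis norm_triangle_ineq)
    ultimately show ?thesis by (simp add: field_simps)
  qed
  then have "norm (\<Sum>j\<in>J. e j0 + f j) \<le> card J * ((1 + c) / 2)"
    by (rule sum_norm_bound)
  moreover have "(\<Sum>j\<in>J. e j0 + f j) = real (card J) *\<^sub>R e j0 + (\<Sum>j\<in>J. f j)"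
    by (simp add: sum.distrib sum_constant_scaleR)
  moreover have "norm (real (card J) *\<^sub>R e j0) \<le> norm (real (card J) *\<^sub>R e j0 + (\<Sum>j\<in>J. f j)) + norm (\<Sum>j\<in>J. f j)"
    by (metis add_diff_cancel_right' norm_triangle_ineq4)
  moreover have "norm (e j0) = 1" using ea(2) j0 J by auto
  \<comment> \<open>The bound does not grow with \<open>J\<close>: the blocks are disjoint parts of
    one sup-norm basis, and each coefficient is at most
    \<open>norm (f j) \<le> c + 1 < 2\<close>.\<close>
  moreover have "norm (\<Sum>j\<in>J. f j) \<le> 3 * 2"
  proof -
    have "linf_basis (J \<times> I) z"
      by (rule linf_basis_subset[OF _ _ z]) (use assms(4) J in auto)
    moreover have "\<bar>a j i\<bar> \<le> 2" if "j \<in> J" "i \<in> I" for j i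
    proof -
      have "j < L" using that J by auto
      have "\<bar>a j i\<bar> \<le> norm (f j)"
        unfolding f_def by (rule linf_basis_lower[OF block[OF \<open>j < L\<close>] that(2)])
      also have "\<dots> \<le> norm (e j + f j) + norm (e j)"
        by (metis add_diff_cancel_left' norm_triangle_ineq4)
      finally show ?thesis
        using ea(2,3)[OF \<open>j < L\<close>] assms(3) by (simp add: f_def)
    qed
    ultimately have "norm (\<Sum>p\<in>J \<times> I. case_prod a p *\<^sub>R z p) \<le> 3 * 2"
      by (intro linf_basis_upper) auto
    then show ?thesis
      by (simp add: f_def sum.cartesian_product case_prod_unfold)
  qed
  ultimately have "real (card J) \<le> card J * ((1 + c) / 2) + 6" by simp
  then have "card J * (1 - c) \<le> 12" by (simp add: field_simps)
  then have "card J \<le> 12 / (1 - c)" using assms(3) by (simp add: field_simps)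
  with m J(1) show False by simp
qed

section \<open>Successive copies with bounded coordinates\<close>

text \<open>Stands in for the unit sphere of a finite-dimensional span: once coordinates are bounded
  by a multiple of the norm, unit vectors have coefficients in a fixed box.\<close>

lemma compact_bounded_combinations:
  fixes z :: "'i \<Rightarrow> 'b::real_normed_vector"
  assumes "finite I"
  shows "compact {\<Sum>i\<in>I. a i *\<^sub>R z i | a. \<forall>i\<in>I. \<bar>a i\<bar> \<le> t}"
  using assms
proof (induction I rule: finite_induct)
  case empty
  then show ?case by simp
next
  case (insert j I)
  define K where "K = {\<Sum>i\<in>I. a i *\<^sub>R z i | a. \<forall>i\<in>I. \<bar>a i\<bar> \<le> t}"
  define S where "S = (\<lambda>r. r *\<^sub>R z j) ` {-t..t}"
  have "compact S"
    unfolding S_def by (intro compact_continuous_image continuous_intros) auto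
  moreover have "{\<Sum>i\<in>insert j I. a i *\<^sub>R z i | a. \<forall>i\<in>insert j I. \<bar>a i\<bar> \<le> t} = {x + y | x y. x \<in> S \<and> y \<in> K}"
    (is "?L = ?R")
  proof (intro equalityI subsetI)
    fix v assume "v \<in> ?L"
    then obtain a where "v = (\<Sum>i\<in>insert j I. a i *\<^sub>R z i)" "\<forall>i\<in>insert j I. \<bar>a i\<bar> \<le> t" by blast
    moreover from this have "a j *\<^sub>R z j \<in> S" "(\<Sum>i\<in>I. a i *\<^sub>R z i) \<in> K"
      by (auto simp: S_def K_def abs_le_iff)
    ultimately show "v \<in> ?R" using insert.hyps by auto
  next
    fix v assume "v \<in> ?R"
    then obtain r a where v: "v = r *\<^sub>R z j + (\<Sum>i\<in>I. a i *\<^sub>R z i)" "\<bar>r\<bar> \<le> t" "\<forall>i\<in>I. \<bar>a i\<bar> \<le> t"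
      by (auto simp: S_def K_def abs_le_iff)
    have "(\<Sum>i\<in>I. (a(j := r)) i *\<^sub>R z i) = (\<Sum>i\<in>I. a i *\<^sub>R z i)"
      using insert.hyps by (intro sum.cong) auto
    then have "v = (\<Sum>i\<in>insert j I. (a(j := r)) i *\<^sub>R z i)"
      using v insert.hyps by simp
    then show "v \<in> ?L" using v(2,3) by (auto intro!: exI[of _ "a(j := r)"])
  qed
  ultimately show ?case
    using compact_sums[of S K] insert.IH unfolding K_def[symmetric] by simp
qed

lemma exists_linf_decomposition:
  fixes I :: "nat \<Rightarrow> 'i set"
  assumes "without_cotype TYPE('b::real_normed_vector)" "\<And>k. finite (I k)"
  shows "\<exists>z :: nat \<Rightarrow> 'i \<Rightarrow> 'b. (\<forall>k. linf_basis (I k) (z k)) \<and>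
    (\<forall>N a. \<forall>k<N. \<forall>i\<in>I k. \<bar>a k i\<bar> \<le> 4 * norm (\<Sum>k<N. \<Sum>i\<in>I k. a k i *\<^sub>R z k i))"
proof -
  \<comment> \<open>The partial sums \<open>U a z N\<close> are kept such that \<open>s N * norm (U a z N)\<close> increases with \<open>N\<close>;
    as \<open>1 \<le> s \<le> 2\<close>, this bounds the basis constant by \<open>2\<close>.\<close>
  define s :: "nat \<Rightarrow> real" where "s k = 2 - 1 / Suc k" for k
  have s: "1 \<le> s k" "s k \<le> 2" "s k < s (Suc k)" for k
    by (auto simp: s_def field_simps)
  define U :: "(nat \<Rightarrow> 'i \<Rightarrow> real) \<Rightarrow> (nat \<Rightarrow> 'i \<Rightarrow> 'b) \<Rightarrow> nat \<Rightarrow> 'b"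
    where "U a z N = (\<Sum>k<N. \<Sum>i\<in>I k. a k i *\<^sub>R z k i)" for a z N
  define P where "P z N r \<longleftrightarrow> linf_basis (I N) r \<and>
      (\<forall>a b. s N * norm (U a z N) \<le> s (Suc N) * norm (U a z N + (\<Sum>i\<in>I N. b i *\<^sub>R r i)))" for z N r
  \<comment> \<open>Block \<open>k\<close> is the difference of two consecutive partial sums, each
    at most twice as long as \<open>U a z N\<close>; hence \<open>4\<close>. Only blocks below
    \<open>N\<close> are assumed good, so the estimate is available during the construction.\<close>
  have bound: "\<bar>a k i\<bar> \<le> 4 * norm (U a z N)"
    if P: "\<And>k. k < N \<Longrightarrow> P z k (z k)" and k: "k < N" "i \<in> I k" for z N a k i
  proof -
    have U_step: "s j * norm (U a z j) \<le> s (Suc j) * norm (U a z (Suc j))" if "j < N" for j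
      using P[OF that] unfolding P_def by (simp add: U_def)
    have "s j * norm (U a z j) \<le> s N * norm (U a z N)" if "j \<le> N" for j
      using that
    proof (induction rule: inc_induct)
      case base
      show ?case by simp
    next
      case (step j)
      then show ?case using U_step by (meson order_trans)
    qed
    moreover have "norm (U a z j) \<le> s j * norm (U a z j)" "s N * norm (U a z N) \<le> 2 * norm (U a z N)" for j
      using mult_right_mono[OF s(1)[of j], of "norm (U a z j)"] mult_right_mono[OF s(2)[of N], of "norm (U a z N)"] by auto
    ultimately have le: "norm (U a z j) \<le> 2 * norm (U a z N)" if "j \<le> N" for j
      using that by (meson order_trans)
    have "\<bar>a k i\<bar> \<le> norm (\<Sum>i\<in>I k. a k i *\<^sub>R z k i)"
      using P[OF k(1)] k(2) unfolding P_def by (blast intro: linf_basis_lower)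
    also have "(\<Sum>i\<in>I k. a k i *\<^sub>R z k i) = U a z (Suc k) - U a z k"
      by (simp add: U_def)
    also have "norm \<dots> \<le> norm (U a z (Suc k)) + norm (U a z k)"
      by (rule norm_triangle_ineq4)
    also have "\<dots> \<le> 4 * norm (U a z N)"
      using le[of k] le[of "Suc k"] k by simp
    finally show ?thesis .
  qed
  have "\<exists>z. \<forall>N. P z N (z N)"
  proof (rule dependent_wellorder_choice)
    fix r and z z' :: "nat \<Rightarrow> 'i \<Rightarrow> 'b" and N
    assume "\<And>k. k < N \<Longrightarrow> z k = z' k"
    then have "U a z N = U a z' N" for a unfolding U_def by (intro sum.cong) auto
    then show "P z N r = P z' N r" by (simp add: P_def)
  next
    fix N and z :: "nat \<Rightarrow> 'i \<Rightarrow> 'b"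
    assume prev: "\<And>k. k < N \<Longrightarrow> P z k (z k)"
    \<comment> \<open>By \<open>bound\<close>, every normalised partial sum has coefficients of
      modulus at most \<open>4\<close> and so lies in \<open>K\<close>.\<close>
    define K where "K = {\<Sum>p\<in>Sigma {..<N} I. a p *\<^sub>R case_prod z p | a. \<forall>p\<in>Sigma {..<N} I. \<bar>a p\<bar> \<le> 4}"
    have "compact K"
      unfolding K_def using assms(2) by (intro compact_bounded_combinations) auto
    have "s N / s (Suc N) < 1" using s[of N] by (simp add: field_simps)
    from exists_linf_basis_away_from_compact[OF assms(1) \<open>compact K\<close> this assms(2)[of N]]
    obtain r :: "'i \<Rightarrow> 'b" where r: "linf_basis (I N) r"
      "\<forall>e\<in>K. norm e = 1 \<longrightarrow> (\<forall>b. s N / s (Suc N) \<le> norm (e + (\<Sum>i\<in>I N. b i *\<^sub>R r i)))"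
      by blast
    have "s N * norm (U a z N) \<le> s (Suc N) * norm (U a z N + (\<Sum>i\<in>I N. b i *\<^sub>R r i))" for a b
    proof (cases "U a z N = 0")
      case True
      then show ?thesis using s(1)[of "Suc N"] by simp
    next
      case False
      define t where "t = norm (U a z N)"
      have t: "t > 0" using False by (simp add: t_def)
      define e where "e = (1 / t) *\<^sub>R U a z N"
      have "e = (\<Sum>p\<in>Sigma {..<N} I. (case_prod a p / t) *\<^sub>R case_prod z p)"
        unfolding e_def U_def scaleR_sum_right using assms(2) by (simp add: sum.Sigma case_prod_unfold)
      moreover have "\<bar>case_prod a p / t\<bar> \<le> 4" if "p \<in> Sigma {..<N} I" for p
        using bound[OF prev, of N "fst p" "snd p" a] that t
        by (auto simp: t_def field_simps)
      ultimately have "e \<in> K"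
        unfolding K_def by (intro CollectI exI[of _ "\<lambda>p. case_prod a p / t"]) simp
      moreover have "norm e = 1" using t by (simp add: e_def t_def)
      ultimately have "s N / s (Suc N) \<le> norm (e + (\<Sum>i\<in>I N. (b i / t) *\<^sub>R r i))"
        by (rule r(2)[rule_format])
      also have "e + (\<Sum>i\<in>I N. (b i / t) *\<^sub>R r i) = (1 / t) *\<^sub>R (U a z N + (\<Sum>i\<in>I N. b i *\<^sub>R r i))"
        by (simp add: e_def scaleR_add_right scaleR_sum_right)
      also have "norm \<dots> = norm (U a z N + (\<Sum>i\<in>I N. b i *\<^sub>R r i)) / t"
        using t by simp
      finally show ?thesis
        using t s(1)[of "Suc N"] by (simp add: field_simps t_def)
    qed
    with r(1) show "\<exists>r. P z N r" unfolding P_def by blast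
  qed
  then obtain z where z: "\<And>N. P z N (z N)" by blast
  then show ?thesis
    using bound[where z = z] unfolding P_def U_def by (intro exI[of _ z]) blast
qed

section \<open>The embedding\<close>

text \<open>A separate slope \<open>\<eta>\<close> for each scale \<open>e\<close> suffices: small
  \<open>e\<close> gives uniform continuity of the inverse, and \<open>e = 1\<close> alone makes the
  compression grow at least linearly.\<close>

lemma strong_uniform_embeddingI:
  fixes f :: "'m::metric_space \<Rightarrow> 'b::metric_space"
  assumes "0 \<le> L"
    and upper: "\<And>x y. x \<in> M \<Longrightarrow> y \<in> M \<Longrightarrow> dist (f x) (f y) \<le> L * dist x y"
    and lower: "\<And>e. 0 < e \<Longrightarrow> \<exists>\<eta>>0. \<forall>x\<in>M. \<forall>y\<in>M. e \<le> dist x y \<longrightarrow> \<eta> * dist x y \<le> dist (f x) (f y)"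
  shows "strong_uniform_embedding M f"
proof -
  have inj: "inj_on f M"
  proof (rule inj_onI)
    fix x y assume xy: "x \<in> M" "y \<in> M" "f x = f y"
    show "x = y"
    proof (rule ccontr)
      assume "x \<noteq> y"
      then have d: "0 < dist x y" by simp
      from lower[OF d] obtain \<eta> where "\<eta> > 0" "\<eta> * dist x y \<le> dist (f x) (f y)"
        using xy by blast
      then show False using d xy(3) by (simp add: mult_le_0_iff)
    qed
  qed
  have "L-lipschitz_on M f"
    using assms(1) upper by (intro lipschitz_onI) auto
  then have uc: "uniformly_continuous_on M f"
    by (rule lipschitz_on_uniformly_continuous)
  have "uniformly_continuous_on (f ` M) (inv_into M f)"
    unfolding uniformly_continuous_on_def
  proof (intro allI impI)
    fix e :: real assume "0 < e"
    from lower[OF this] obtain \<eta> where \<eta>: "\<eta> > 0"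
      "\<forall>x\<in>M. \<forall>y\<in>M. e \<le> dist x y \<longrightarrow> \<eta> * dist x y \<le> dist (f x) (f y)" by blast
    have "dist x y < e" if "x \<in> M" "y \<in> M" "dist (f x) (f y) < \<eta> * e" for x y
    proof (rule ccontr)
      assume "\<not> ?thesis"
      then have "e \<le> dist x y" by simp
      then have "\<eta> * e \<le> \<eta> * dist x y" "\<eta> * dist x y \<le> dist (f x) (f y)"
        using \<eta> that by auto
      with that(3) show False by simp
    qed
    then show "\<exists>d>0. \<forall>x\<in>f ` M. \<forall>x'\<in>f ` M. dist x' x < d \<longrightarrow> dist (inv_into M f x') (inv_into M f x) < e"
      using inj \<eta>(1) \<open>0 < e\<close> by (intro exI[of _ "\<eta> * e"]) auto
  qed
  moreover have "expansion_modulus M f t < \<infinity>" for t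
  proof -
    have "expansion_modulus M f t \<le> ennreal (L * t)"
      unfolding expansion_modulus_def
    proof (rule Sup_least, clarify)
      fix x y assume "x \<in> M" "y \<in> M" "dist x y \<le> t"
      then show "ennreal (dist (f x) (f y)) \<le> ennreal (L * t)"
        by (intro ennreal_leI order_trans[OF upper] mult_left_mono) (use assms(1) in auto)
    qed
    then show ?thesis by (simp add: order_le_less_trans)
  qed
  moreover have "(compression_modulus M f \<longlongrightarrow> \<infinity>) at_top"
    unfolding infinity_ennreal_def tendsto_top_iff_ennreal
  proof (intro allI impI)
    fix l :: real assume "0 \<le> l"
    obtain \<eta> where \<eta>: "\<eta> > 0"
      "\<forall>x\<in>M. \<forall>y\<in>M. 1 \<le> dist x y \<longrightarrow> \<eta> * dist x y \<le> dist (f x) (f y)"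
      using lower[of 1] by auto
    have "ennreal l < compression_modulus M f t" if t: "max 1 ((l + 1) / \<eta>) \<le> t" for t
    proof -
      have "ennreal l < ennreal (l + 1)" using \<open>0 \<le> l\<close> by (simp add: ennreal_less_iff)
      also have "\<dots> \<le> compression_modulus M f t"
        unfolding compression_modulus_def
      proof (rule Inf_greatest, clarify)
        fix x y assume xy: "x \<in> M" "y \<in> M" "t \<le> dist x y"
        have "l + 1 \<le> \<eta> * t" using t \<eta>(1) by (simp add: field_simps)
        also have "\<dots> \<le> \<eta> * dist x y" using xy \<eta>(1) by simp
        also have "\<dots> \<le> dist (f x) (f y)" using xy t \<eta>(2) by auto
        finally show "ennreal (l + 1) \<le> ennreal (dist (f x) (f y))" by (rule ennreal_leI)
      qed
      finally show ?thesis .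
    qed
    then show "\<forall>\<^sub>F t in at_top. ennreal l < compression_modulus M f t"
      unfolding eventually_at_top_linorder by blast
  qed
  ultimately show ?thesis
    using inj uc by (simp add: strong_uniform_embedding_def uniform_embedding_def coarse_embedding_def)
qed

section \<open>Dyadic shells and bump functions\<close>

text \<open>Shells overlap so that a point with \<open>2 ^ (k + 1) \<le> t < 2 ^ (k + 2)\<close>
  sits well inside shell \<open>k\<close>. The numeric value can weight estimates and be summed over
  \<open>k\<close>.\<close>

definition in_shell :: "nat \<Rightarrow> real \<Rightarrow> real" where
  "in_shell k t = (if 2 ^ k < t \<and> t < 2 ^ (k + 3) then 1 else 0)"

lemma sum_in_shell_le: "(\<Sum>k<N. in_shell k t) \<le> 3"
proof (cases "{k \<in> {..<N}. 2 ^ k < t \<and> t < 2 ^ (k + 3)} = {}")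
  case True
  then have "(\<Sum>k<N. in_shell k t) = 0" by (intro sum.neutral) (auto simp: in_shell_def)
  then show ?thesis by simp
next
  case False
  define S where "S = {k \<in> {..<N}. 2 ^ k < t \<and> t < 2 ^ (k + 3)}"
  have S: "finite S" "S \<noteq> {}" using False by (auto simp: S_def)
  have "k < Min S + 3" if "k \<in> S" for k
  proof -
    have "(2::real) ^ k < t" "t < 2 ^ (Min S + 3)"
      using that Min_in[OF S] by (auto simp: S_def)
    then have "(2::real) ^ k < 2 ^ (Min S + 3)" by (rule less_trans)
    then show ?thesis by (simp only: power_strict_increasing_iff one_less_numeral_iff semiring_norm)
  qed
  then have "S \<subseteq> {Min S..<Min S + 3}" using S by auto
  then have "card S \<le> card {Min S..<Min S + 3}" by (intro card_mono) auto
  moreover have "(\<Sum>k<N. in_shell k t) = card S"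
    by (simp add: in_shell_def S_def sum.If_cases Int_def)
  ultimately show ?thesis by simp
qed

text \<open>A tent over the shell of index \<open>k\<close>, cut down to a neighbourhood of \<open>p\<close>. The slope \<open>2\<close> in
  the distance to \<open>p\<close> beats the slope \<open>1\<close> of the tent, so that the function decreases away
  from \<open>p\<close>.\<close>

definition bump :: "'m::metric_space \<Rightarrow> nat \<Rightarrow> 'm \<Rightarrow> 'm \<Rightarrow> real" where
  "bump o\<^sub>0 k p x =
     max 0 (min (2 + dist x o\<^sub>0 - 2 ^ k) (2 ^ (k + 3) - (2 + dist x o\<^sub>0)) - 2 * dist x p)"

lemma bump_bounds: "0 \<le> bump o\<^sub>0 k p x" "bump o\<^sub>0 k p x \<le> in_shell k (2 + dist x o\<^sub>0) * (2 + dist x o\<^sub>0)"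
proof -
  have nn: "0 \<le> dist x p" "0 \<le> dist x o\<^sub>0" "(0::real) < 2 ^ k" by simp_all
  show "0 \<le> bump o\<^sub>0 k p x" by (simp add: bump_def)
  show "bump o\<^sub>0 k p x \<le> in_shell k (2 + dist x o\<^sub>0) * (2 + dist x o\<^sub>0)"
  proof (cases "2 ^ k < 2 + dist x o\<^sub>0 \<and> 2 + dist x o\<^sub>0 < 2 ^ (k + 3)")
    case True
    then have one: "in_shell k (2 + dist x o\<^sub>0) = 1" by (simp add: in_shell_def)
    show ?thesis using nn unfolding bump_def one mult_1 by linarith
  next
    case False
    then have zero: "in_shell k (2 + dist x o\<^sub>0) = 0" by (simp add: in_shell_def)
    show ?thesis using nn False unfolding bump_def zero mult_zero_left by linarith
  qed
qed

text \<open>The slope \<open>3\<close> is \<open>1\<close> from the tent plus \<open>2\<close> from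
  the distance to \<open>p\<close>. The indicator factor, at least \<open>1\<close> unless both
  bumps vanish, keeps the later sum over shells bounded.\<close>

lemma bump_lipschitz:
  "\<bar>bump o\<^sub>0 k p x - bump o\<^sub>0 k p y\<bar>
     \<le> 3 * dist x y * (in_shell k (2 + dist x o\<^sub>0) + in_shell k (2 + dist y o\<^sub>0))"
proof (cases "in_shell k (2 + dist x o\<^sub>0) + in_shell k (2 + dist y o\<^sub>0) = 0")
  case True
  then have "in_shell k (2 + dist x o\<^sub>0) = 0" "in_shell k (2 + dist y o\<^sub>0) = 0"
    by (auto simp: in_shell_def split: if_splits)
  then have "bump o\<^sub>0 k p x = 0" "bump o\<^sub>0 k p y = 0"
    using bump_bounds[of o\<^sub>0 k p x] bump_bounds[of o\<^sub>0 k p y] by auto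
  then show ?thesis using True by simp
next
  case False
  then have "1 \<le> in_shell k (2 + dist x o\<^sub>0) + in_shell k (2 + dist y o\<^sub>0)"
    unfolding in_shell_def by (auto simp only: split: if_splits)
  from mult_left_mono[OF this, of "3 * dist x y"]
  have "3 * dist x y \<le> 3 * dist x y * (in_shell k (2 + dist x o\<^sub>0) + in_shell k (2 + dist y o\<^sub>0))" by simp
  moreover have "\<bar>dist x o\<^sub>0 - dist y o\<^sub>0\<bar> \<le> dist x y" "\<bar>dist x p - dist y p\<bar> \<le> dist x y"
    using abs_dist_diff_le[of x o\<^sub>0 y] abs_dist_diff_le[of x p y] by (simp_all add: dist_commute)
  then have "\<bar>bump o\<^sub>0 k p x - bump o\<^sub>0 k p y\<bar> \<le> 3 * dist x y"
    unfolding bump_def by (simp add: abs_le_iff max_def min_def)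
  ultimately show ?thesis by linarith
qed

text \<open>The centre is near \<open>y\<close>, the point farther from the base, and the tent is
  still rising there. Let \<open>t = 2 + dist y o\<^sub>0\<close>. If the bump vanishes at
  \<open>x\<close>, its value at \<open>y\<close> is at least \<open>t / 2 - 2 * \<epsilon>\<close>,
  while \<open>dist x y \<le> 2 * t\<close>; otherwise the distances to \<open>p\<close> alone yield
  \<open>2 * dist x y - 4 * \<epsilon>\<close>.\<close>

lemma bump_separates:
  assumes "dist x o\<^sub>0 \<le> dist y o\<^sub>0" "2 ^ (k + 1) \<le> 2 + dist y o\<^sub>0" "2 + dist y o\<^sub>0 < 2 ^ (k + 2)"
    and "dist y p \<le> \<epsilon>"
  shows "dist x y / 4 - 4 * \<epsilon> \<le> bump o\<^sub>0 k p y - bump o\<^sub>0 k p x"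
proof -
  define A :: real where "A = 2 ^ k"
  have pow: "2 ^ (k + 1) = 2 * A" "2 ^ (k + 2) = 4 * A" "2 ^ (k + 3) = 8 * A"
    by (simp_all add: A_def power_add)
  have "dist x y \<le> dist x o\<^sub>0 + dist y o\<^sub>0" by (rule dist_triangle2)
  moreover have "dist x y \<le> dist x p + dist y p" by (rule dist_triangle2)
  moreover have "dist y o\<^sub>0 \<le> dist x y + dist x o\<^sub>0" "dist x o\<^sub>0 \<le> dist x y + dist y o\<^sub>0"
    by (metis dist_commute dist_triangle)+
  moreover have "0 \<le> dist y p" "0 \<le> dist x o\<^sub>0" "0 \<le> dist x p" "0 \<le> dist x y" by simp_all
  ultimately show ?thesis
    using assms unfolding bump_def pow A_def[symmetric] by linarith
qed

text \<open>The first \<open>N\<close> codes decode into a square of side \<open>N\<close>, on which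
  the double sum factors; the \<open>2\<close> is the full geometric series.\<close>

lemma summable_prod_decode_weights:
  fixes c :: "nat \<Rightarrow> real"
  assumes "\<And>k. 0 \<le> c k" "\<And>N. (\<Sum>k<N. c k) \<le> B"
  defines "h \<equiv> \<lambda>m. (1/2) ^ snd (prod_decode m) * c (fst (prod_decode m))"
  shows "summable h" "suminf h \<le> 2 * B"
proof -
  have B: "0 \<le> B" using assms(2)[of 0] by simp
  have h: "0 \<le> h m" for m unfolding h_def using assms(1) by simp
  have le: "(\<Sum>m<N. h m) \<le> 2 * B" for N
  proof -
    have "prod_decode ` {..<N} \<subseteq> {..<N} \<times> {..<N}"
    proof clarify
      fix m k j assume m: "m < N" "(k, j) = prod_decode m"
      then have "prod_encode (k, j) = m" by simp
      then show "k \<in> {..<N} \<and> j \<in> {..<N}"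
        using m(1) le_prod_encode_1[of k j] le_prod_encode_2[of j k] by auto
    qed
    have "(\<Sum>m<N. h m) = (\<Sum>(k, j)\<in>prod_decode ` {..<N}. (1/2) ^ j * c k)"
      using inj_prod_decode by (subst sum.reindex) (auto simp: h_def case_prod_unfold)
    also have "\<dots> \<le> (\<Sum>(k, j)\<in>{..<N} \<times> {..<N}. (1/2) ^ j * c k)"
      by (rule sum_mono2) (use assms(1) \<open>prod_decode ` {..<N} \<subseteq> _\<close> in auto)
    also have "\<dots> = (\<Sum>k<N. c k) * (\<Sum>j<N. (1/2) ^ j)"
      by (simp add: sum.cartesian_product[symmetric] sum_product mult.commute)
    also have "\<dots> \<le> B * 2"
    proof (rule mult_mono)
      have "(\<Sum>j<N. (1/2::real) ^ j) \<le> (\<Sum>j. (1/2) ^ j)"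
        by (intro sum_le_suminf summable_geometric) auto
      then show "(\<Sum>j<N. (1/2::real) ^ j) \<le> 2" by (simp add: suminf_geometric)
    qed (use assms B in \<open>auto intro: sum_nonneg\<close>)
    finally show ?thesis by simp
  qed
  show "summable h" using h le by (rule summableI_nonneg_bounded)
  then show "suminf h \<le> 2 * B" using le by (rule suminf_le_const)
qed

lemma exists_power_shell:
  assumes "2 \<le> t"
  shows "\<exists>k. 2 ^ (k + 1) \<le> t \<and> t < (2::real) ^ (k + 2)"
proof -
  \<comment> \<open>Powers of two are integers, so bounds for the floor of \<open>t / 2\<close>
    transfer to \<open>t / 2\<close>; halving accounts for the shifted exponents.\<close>
  have "1 \<le> nat \<lfloor>t / 2\<rfloor>" using assms by (simp add: le_nat_iff)
  then obtain k where k: "2 ^ k \<le> nat \<lfloor>t / 2\<rfloor>" "nat \<lfloor>t / 2\<rfloor> < 2 ^ (k + 1)"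
    using ex_power_ivl1[of 2] by blast
  have "2 ^ k \<le> \<lfloor>t / 2\<rfloor>" "\<lfloor>t / 2\<rfloor> < 2 ^ (k + 1)"
    using k assms by (simp_all add: le_nat_iff nat_less_iff)
  then have "2 ^ k \<le> t / 2" "t / 2 < 2 ^ (k + 1)"
    by (simp_all add: le_floor_iff floor_less_iff)
  then show ?thesis by (intro exI[of _ k]) simp
qed

lemma finite_net_in_ball:
  assumes "proper_space M" "o\<^sub>0 \<in> M" "0 < \<epsilon>"
  shows "\<exists>P. finite P \<and> (\<forall>y\<in>M. dist y o\<^sub>0 \<le> r \<longrightarrow> (\<exists>p\<in>P. dist y p < \<epsilon>))"
proof -
  have "compact (M \<inter> cball o\<^sub>0 r)" using assms(1,2) by (simp add: proper_space_def)
  then obtain P where "finite P" "M \<inter> cball o\<^sub>0 r \<subseteq> (\<Union>p\<in>P. ball p \<epsilon>)"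
    using assms(3) unfolding compact_eq_totally_bounded by blast
  then show ?thesis by (intro exI[of _ P]) (auto simp: dist_commute subset_iff)
qed

theorem theorem2p1:
  fixes M :: "'m::metric_space set"
  assumes "proper_space M"
    and "without_cotype TYPE('b::banach)"
  shows "\<exists>f :: 'm \<Rightarrow> 'b. strong_uniform_embedding M f"
proof (cases "M = {}")
  case True
  then have "strong_uniform_embedding M (\<lambda>_. 0 :: 'b)"
    by (intro strong_uniform_embeddingI[of 0]) (auto intro: exI[of _ 1])
  then show ?thesis by blast
next
  case False
  then obtain o\<^sub>0 where o: "o\<^sub>0 \<in> M" by blast
  \<comment> \<open>The shift by \<open>2\<close> places every point, even the base point, in some
    \<open>2 ^ (k + 1) \<le> t x < 2 ^ (k + 2)\<close> with \<open>k\<close> natural.\<close>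
  define t where "t x = 2 + dist x o\<^sub>0" for x
  \<comment> \<open>A block \<open>m\<close> codes a pair: the shell \<open>K m\<close> and the precision \<open>E m\<close> of the net, which is also
    the weight that makes the sum over all precisions converge.\<close>
  define K where "K m = fst (prod_decode m)" for m
  define E :: "nat \<Rightarrow> real" where "E m = (1/2) ^ snd (prod_decode m)" for m
  have E: "E m > 0" for m by (simp add: E_def)
  have "\<forall>m. \<exists>P. finite P \<and> (\<forall>y\<in>M. dist y o\<^sub>0 \<le> 2 ^ (K m + 3) \<longrightarrow> (\<exists>p\<in>P. dist y p < E m))"
    using finite_net_in_ball[OF assms(1) o] E by blast
  then obtain P where P: "\<And>m. finite (P m)"
    "\<And>m y. y \<in> M \<Longrightarrow> dist y o\<^sub>0 \<le> 2 ^ (K m + 3) \<Longrightarrow> \<exists>p\<in>P m. dist y p < E m"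
    by metis
  \<comment> \<open>Net points index the basis vectors of each copy; the second fact reads a single
    coefficient off any long enough partial sum.\<close>
  obtain z :: "nat \<Rightarrow> 'm \<Rightarrow> 'b" where z: "\<And>m. linf_basis (P m) (z m)"
    "\<And>N a m p. m < N \<Longrightarrow> p \<in> P m \<Longrightarrow> \<bar>a m p\<bar> \<le> 4 * norm (\<Sum>m<N. \<Sum>p\<in>P m. a m p *\<^sub>R z m p)"
    using exists_linf_decomposition[OF assms(2), of P] P(1) by blast
  define g where "g m x p = E m * bump o\<^sub>0 (K m) p x" for m x p
  define G where "G m x = (\<Sum>p\<in>P m. g m x p *\<^sub>R z m p)" for m x
  define f where "f x = (\<Sum>m. G m x)" for x

  \<comment> \<open>Convergence and the Lipschitz bound\<close>
  have G_diff: "G m x - G m y = (\<Sum>p\<in>P m. (g m x p - g m y p) *\<^sub>R z m p)" for m x y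
    by (simp add: G_def sum_subtractf scaleR_diff_left)
  have norm_G: "norm (G m x) \<le> 3 * t x * (E m * in_shell (K m) (t x))" for m x
  proof -
    have "norm (G m x) \<le> 3 * (E m * (in_shell (K m) (t x) * t x))"
      unfolding G_def
    proof (rule linf_basis_upper[OF z(1)])
      fix p
      show "\<bar>g m x p\<bar> \<le> E m * (in_shell (K m) (t x) * t x)"
        using bump_bounds[of o\<^sub>0 "K m" p x] E[of m] by (simp add: g_def t_def abs_mult)
    qed (simp add: E_def in_shell_def t_def)
    then show ?thesis by (simp add: mult_ac)
  qed
  have norm_G_diff: "norm (G m x - G m y) \<le> 9 * dist x y * (E m * (in_shell (K m) (t x) + in_shell (K m) (t y)))" for m x y
  proof -
    have "norm (G m x - G m y) \<le> 3 * (E m * (3 * dist x y * (in_shell (K m) (t x) + in_shell (K m) (t y))))"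
      unfolding G_diff
    proof (rule linf_basis_upper[OF z(1)])
      fix p
      have "\<bar>g m x p - g m y p\<bar> = E m * \<bar>bump o\<^sub>0 (K m) p x - bump o\<^sub>0 (K m) p y\<bar>"
        using E[of m] by (simp add: g_def right_diff_distrib[symmetric] abs_mult)
      then show "\<bar>g m x p - g m y p\<bar> \<le> E m * (3 * dist x y * (in_shell (K m) (t x) + in_shell (K m) (t y)))"
        using bump_lipschitz[of o\<^sub>0 "K m" p x y] E[of m] by (simp add: t_def)
    qed (simp add: E_def in_shell_def)
    then show ?thesis by (simp add: mult_ac)
  qed
  have shell_nonneg: "0 \<le> in_shell k s" for k s by (simp add: in_shell_def)
  have sum_G: "summable (\<lambda>m. G m x)" for x
  proof (rule summable_comparison_test')
    show "summable (\<lambda>m. 3 * t x * (E m * in_shell (K m) (t x)))"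
      unfolding E_def K_def
      by (intro summable_mult summable_prod_decode_weights[where B = 3] shell_nonneg sum_in_shell_le)
  qed (rule norm_G)
  have f_diff: "f x - f y = (\<Sum>m. G m x - G m y)" for x y
    unfolding f_def by (rule suminf_diff[OF sum_G sum_G])
  have upper: "dist (f x) (f y) \<le> 108 * dist x y" for x y
  proof -
    define h where "h m = E m * (in_shell (K m) (t x) + in_shell (K m) (t y))" for m
    have "(\<Sum>k<N. in_shell k (t x) + in_shell k (t y)) \<le> 6" for N
      using sum_in_shell_le[of "t x" N] sum_in_shell_le[of "t y" N] by (simp add: sum.distrib)
    then have h: "summable h" "suminf h \<le> 2 * 6"
      unfolding h_def E_def K_def
      by (intro summable_prod_decode_weights add_nonneg_nonneg shell_nonneg; assumption)+
    \<comment> \<open>The constant \<open>108\<close> is \<open>9 * 2 * 6\<close>: basis constant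
      times bump slope, the geometric series, and three shells for each of the two points.\<close>
    have "norm (f x - f y) \<le> (\<Sum>m. 9 * dist x y * h m)"
      unfolding f_diff
      by (rule norm_suminf_le[OF _ summable_mult[OF h(1)]]) (unfold h_def, rule norm_G_diff)
    also have "\<dots> = 9 * dist x y * suminf h"
      by (rule suminf_mult[OF h(1)])
    also have "\<dots> \<le> 9 * dist x y * (2 * 6)"
      using h(2) by (intro mult_left_mono) auto
    finally show ?thesis by (simp add: dist_norm)
  qed

  \<comment> \<open>Recovering distances from coefficients\<close>
  have coeff: "\<bar>g m x p - g m y p\<bar> \<le> 4 * dist (f x) (f y)" if "p \<in> P m" for m p x y
  proof (rule tendsto_lowerbound)
    \<comment> \<open>The coefficient estimate concerns finite sums; it holds for all
      \<open>N > m\<close> with a fixed left side and so passes to the limit.\<close>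
    show "(\<lambda>N. 4 * norm (\<Sum>m<N. G m x - G m y)) \<longlonglongrightarrow> 4 * dist (f x) (f y)"
      unfolding dist_norm f_diff
      by (intro tendsto_mult_left tendsto_norm summable_LIMSEQ summable_diff sum_G)
    show "\<forall>\<^sub>F N in sequentially. \<bar>g m x p - g m y p\<bar> \<le> 4 * norm (\<Sum>m<N. G m x - G m y)"
      unfolding G_diff using z(2)[OF _ that, of _ "\<lambda>m p. g m x p - g m y p"]
      by (intro eventually_mono[OF eventually_gt_at_top[of m]])
  qed simp
  have lower: "(1/2) ^ j * (dist x y / 4 - 4 * (1/2) ^ j) \<le> 4 * dist (f x) (f y)"
    if xy: "x \<in> M" "y \<in> M" "dist x o\<^sub>0 \<le> dist y o\<^sub>0" for x y j
  proof -
    obtain k where k: "2 ^ (k + 1) \<le> 2 + dist y o\<^sub>0" "2 + dist y o\<^sub>0 < 2 ^ (k + 2)"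
      using exists_power_shell[of "2 + dist y o\<^sub>0"] by auto
    \<comment> \<open>The block belongs to the shell around the farther point \<open>y\<close> at
      precision \<open>j\<close>; the coefficient at a net point near \<open>y\<close> separates
      \<open>x\<close> from \<open>y\<close>.\<close>
    define m where "m = prod_encode (k, j)"
    have m: "K m = k" "E m = (1/2) ^ j" by (simp_all add: m_def K_def E_def)
    have "(2::real) ^ (k + 2) \<le> 2 ^ (k + 3)" by (rule power_increasing) auto
    with k(2) have "dist y o\<^sub>0 \<le> 2 ^ (K m + 3)" unfolding m by linarith
    then obtain p where p: "p \<in> P m" "dist y p < E m" using P(2) xy(2) by blast
    have "dist x y / 4 - 4 * E m \<le> bump o\<^sub>0 k p y - bump o\<^sub>0 k p x"
      by (rule bump_separates[OF xy(3) k]) (use p in simp)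
    then have "E m * (dist x y / 4 - 4 * E m) \<le> g m y p - g m x p"
      unfolding g_def m(1) right_diff_distrib[symmetric] using E[of m] by (intro mult_left_mono) auto
    also have "\<dots> \<le> \<bar>g m x p - g m y p\<bar>" by simp
    also have "\<dots> \<le> 4 * dist (f x) (f y)" by (rule coeff[OF p(1)])
    finally show ?thesis by (simp add: m(2))
  qed
  have "\<exists>\<eta>>0. \<forall>x\<in>M. \<forall>y\<in>M. e \<le> dist x y \<longrightarrow> \<eta> * dist x y \<le> dist (f x) (f y)" if e: "0 < e" for e
  proof -
    \<comment> \<open>The error \<open>4 * (1/2) ^ j\<close> stays below \<open>e / 8\<close>,
      leaving at least \<open>dist x y / 8\<close> of the main term \<open>dist x y / 4\<close>; the
      constant of \<open>lower\<close> then gives the slope \<open>\<theta> / 32\<close>.\<close>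
    obtain j where j: "(1/2) ^ j < e / 32"
      using real_arch_pow_inv[of "e / 32" "1/2"] e by auto
    define \<theta> :: real where "\<theta> = (1/2) ^ j"
    have \<theta>: "\<theta> > 0" "\<theta> < e / 32" using j by (simp_all add: \<theta>_def)
    have "\<theta> / 32 * dist x y \<le> dist (f x) (f y)" if "x \<in> M" "y \<in> M" "e \<le> dist x y" for x y
    proof -
      have "\<theta> * (dist x y / 4 - 4 * \<theta>) \<le> 4 * dist (f x) (f y)"
        using lower[of x y j] lower[of y x j] that by (cases "dist x o\<^sub>0 \<le> dist y o\<^sub>0") (auto simp: \<theta>_def dist_commute)
      moreover have "\<theta> * (dist x y / 8) \<le> \<theta> * (dist x y / 4 - 4 * \<theta>)"
        using \<theta> that by (intro mult_left_mono) auto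
      ultimately show ?thesis by simp
    qed
    then show ?thesis using \<theta>(1) by (intro exI[of _ "\<theta> / 32"]) auto
  qed
  with upper have "strong_uniform_embedding M f"
    by (intro strong_uniform_embeddingI[of 108]) auto
  then show ?thesis by blast
qed

end
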